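(* Let $A(z)$ and $B(z)$ be polynomials in $z$ with complex coefficients, and let $(H_m(z))_{m\ge 0}$ be the sequence of polynomials defined by the generating function $$\sum_{m=0}^{\infty}H_{m}(z)t^{m}=\frac{1}{1+B(z)t+A(z)t^{4}}.$$ Let $\Gamma\subset\mathbb{C}$ be the union of the quartic curve $$\{x+iy:\ x,y\in\mathbb{R},\ 1+2x+2x^{2}+2x^{3}+x^{4}-2y^{2}+2xy^{2}+2x^{2}y^{2}+y^{4}=0\}$$ and the arc $\{q\in\mathbb{C}: |q|=1,\ \Re q\ge-\tfrac13\}$ of the unit circle. If $z_{0}$ is a root of $H_{m}(z)$ for some $m$ and $q=q(z_0)$ is a quotient of two roots in $t$ of $1+B(z_{0})t+A(z_{0})t^{4}$, then $q\in\Gamma$. Moreover, all such quotients are dense on $\Gamma$ as $m\to\infty$: for every $p\in\Gamma$ and every open neighborhood $U$ of $p$ in $\mathbb{C}$, for all sufficiently large $m$ there are a root $z_0$ of $H_m$ and a quotient $q$ of two roots in $t$ of $1+B(z_0)t+A(z_0)t^4$ with $q\in U$.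
   Context: The generating function identity is one of formal power series in $t$ with coefficients in $\mathbb{C}[z]$. A quotient of two roots means $t_i/t_j$ with $i\neq j$, where the roots in $t$ of the polynomial $1+B(z_0)t+A(z_0)t^4$ are listed with multiplicity (they are all nonzero).
   Formalization: The density claim is proved assuming A is nonzero and B^4 is not a constant multiple of A; otherwise it is false: for A = 0 there are no quotients, and for B^4 = cA only finitely many quotients occur, while Γ is infinite. *)

theory Defs
  imports
    "HOL-Computational_Algebra.Computational_Algebra"
    "HOL-Analysis.Analysis"
begin

(* proots lists the roots with multiplicity, so the ratio 1 arises exactly from a
   multiple root. *)
definition root_quotients :: "complex poly \<Rightarrow> complex set" where
  "root_quotients p = {s / t | s t. {#s, t#} \<subseteq># proots p}"

definition quartic_curve :: "complex set" where
  "quartic_curve = {Complex x y | x y.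
     1 + 2 * x + 2 * x^2 + 2 * x^3 + x^4 - 2 * y^2 + 2 * x * y^2 + 2 * x^2 * y^2 + y^4 = 0}"

definition unit_arc :: "complex set" where
  "unit_arc = {q. cmod q = 1 \<and> Re q \<ge> - 1 / 3}"

definition Gamma_set :: "complex set" where
  "Gamma_set = quartic_curve \<union> unit_arc"

(* The polynomial 1 + B(z) t + A(z) t^4 in t; its degree drops when A(z) = 0. *)
definition denom_at :: "complex poly \<Rightarrow> complex poly \<Rightarrow> complex \<Rightarrow> complex poly" where
  "denom_at A B z = [:1, poly B z, 0, 0, poly A z:]"

end

theory Submission
  imports Defs
    "HOL-Complex_Analysis.Conformal_Mappings"
begin

text \<open>
  Where \<open>B(z) \<noteq> 0\<close>, scaling \<open>t\<close> reduces everything to the trinomial \<open>1 - t + c t\<^sup>4\<close> with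
  \<open>c = A(z) / B(z)\<^sup>4\<close>: up to a nonzero factor, \<open>H m\<close> is a fixed polynomial \<open>P m\<close> in \<open>c\<close>
  (\<open>tri_poly\<close>), of degree at most \<open>m div 4\<close>, and quotients of roots are unchanged.  The statement then follows from two facts
  about this trinomial.

  The first one concerns the zeros of \<open>P m\<close>: all of them are real and larger than \<open>27 / 256\<close>, and as
  \<open>m\<close> grows they become dense in that half line (\<open>tri_poly_roots_real\<close>, \<open>tri_poly_roots_dense\<close>).
  For such \<open>c\<close> the trinomial has two pairs of conjugate roots.  Parametrise \<open>c\<close> by the argument \<open>t\<close>,
  between 0 and \<open>\<pi> / 4\<close>, of the pair closer to 0.  Partial fractions express \<open>P m\<close> as a sum over
  the roots, in which the closer pair contributes a positive multiple of
  \<open>cos (m t - phase t)\<close> with a continuous phase, and the other pair always contributes less than the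
  amplitude.  Hence \<open>P m\<close> has the sign \<open>(-1)\<^sup>k\<close> wherever \<open>m t - phase t = k \<pi>\<close>
  (\<open>sign_at_phase\<close>).  Counting the resulting sign changes gives as many real roots as the degree
  permits, and also locates them densely.

  The second one describes the quotients \<open>q \<noteq> 1\<close> of two roots: with \<open>w = q + 1 + 1 / q\<close> and
  \<open>v = w + 1 / w\<close> they satisfy the cubic equation \<open>(v + 2) (v - 2)\<^sup>2 = 1 / c\<close>
  (\<open>invariant_of_roots\<close>, \<open>invariant_eq_resolvent\<close>), and \<open>Gamma_set\<close> is exactly the set of those \<open>q\<close>
  for which \<open>v\<close> is real and between \<open>- 2\<close> and \<open>10 / 3\<close> (\<open>Gamma_set_iff\<close>).  For \<open>c > 27 / 256\<close> the
  cubic has three real roots, all in this interval, which proves that the quotients lie on the set.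
  Conversely, on this interval the left-hand side takes values between 0 and \<open>256 / 27\<close>, and it is
  an open map of \<open>q\<close>; so a neighbourhood of a point of the set realises an interval of values of \<open>c\<close>,
  and density follows from the density of the zeros of \<open>P m\<close>.  All but finitely many of these zeros
  are of the form \<open>A(z) / B(z)\<^sup>4\<close>, since \<open>A\<close> and \<open>B\<^sup>4\<close> are not proportional
  (\<open>finite_unattained_ratios\<close>).
\<close>

section \<open>The normalised sequence and its closed form\<close>

text \<open>
  Up to the scaling in \<open>poly_eq_scaled_tri_poly\<close>, this is the sequence generated by
  \<open>1 / (1 - t + x t\<^sup>4)\<close>, as polynomials in \<open>x\<close>.
\<close>

fun tri_poly :: "nat \<Rightarrow> 'a::comm_ring_1 poly" where
  "tri_poly m = (if m < 4 then 1 else tri_poly (m - 1) - pCons 0 (tri_poly (m - 4)))"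

declare tri_poly.simps [simp del]

lemma tri_poly_initial: "m < 4 \<Longrightarrow> tri_poly m = 1"
  by (simp add: tri_poly.simps)

lemma tri_poly_step: "tri_poly (m + 4) = tri_poly (m + 3) - pCons 0 (tri_poly m)"
  by (subst tri_poly.simps) (simp add: add.commute)

lemma recurrence_induct [case_names initial step]:
  assumes "\<And>m::nat. m < 4 \<Longrightarrow> Q m"
    and "\<And>m. Q m \<Longrightarrow> Q (m + 3) \<Longrightarrow> Q (m + 4)"
  shows "Q m"
proof (induction m rule: less_induct)
  case (less m)
  show ?case
  proof (cases "m < 4")
    case False
    then show ?thesis
      using assms(2)[of "m - 4"] less.IH[of "m - 4"] less.IH[of "m - 4 + 3"] by simp
  qed (use assms(1) in blast)
qed

lemma poly_tri_poly_of_real: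
  "poly (tri_poly m) (of_real x :: 'a::{real_algebra_1,comm_ring_1}) = of_real (poly (tri_poly m) x)"
  by (induction m rule: recurrence_induct)
     (simp_all only: tri_poly_initial tri_poly_step, simp_all)

lemma degree_tri_poly: "degree (tri_poly m :: 'a::comm_ring_1 poly) \<le> m div 4"
proof (induction m rule: recurrence_induct)
  case (step m)
  have "degree (pCons 0 (tri_poly m :: 'a poly)) \<le> (m + 4) div 4"
    using step(1) degree_pCons_le[of 0 "tri_poly m :: 'a poly"] by simp
  moreover have "degree (tri_poly (m + 3) :: 'a poly) \<le> (m + 4) div 4"
    using step(2) by (rule order_trans) (rule div_le_mono, simp)
  ultimately show ?case
    unfolding tri_poly_step by (rule degree_diff_le[rotated])
qed (simp add: tri_poly_initial)

lemma coeff_tri_poly_top: "coeff (tri_poly (4 * n) :: 'a::comm_ring_1 poly) n = (-1) ^ n"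
proof (induction n)
  case (Suc n)
  have "degree (tri_poly (4 * n + 3) :: 'a poly) < Suc n"
    using degree_tri_poly[of "4 * n + 3", where 'a = 'a] by simp
  then have "coeff (tri_poly (4 * n + 3) :: 'a poly) (Suc n) = 0"
    by (rule coeff_eq_0)
  moreover have "4 * Suc n = 4 * n + 4"
    by simp
  ultimately show ?case
    using Suc by (simp only: tri_poly_step) simp
qed (simp add: tri_poly_initial)

lemma tri_poly_nonzero: "tri_poly m \<noteq> (0 :: 'a::comm_ring_1 poly)"
proof -
  have "poly (tri_poly m) (0 :: 'a) = 1"
    by (induction m rule: recurrence_induct)
       (simp_all only: tri_poly_initial tri_poly_step, simp_all)
  then show ?thesis
    by auto
qed

text \<open>
  Replacing \<open>t\<close> by \<open>- t / B(z)\<close> in the denominator \<open>1 + B(z) t + A(z) t\<^sup>4\<close> leaves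
  \<open>1 - t + c t\<^sup>4\<close>, so a zero of \<open>H m\<close> outside the zeros of \<open>B\<close> only depends on the one number
  \<open>c = A(z) / B(z)\<^sup>4\<close>.
\<close>

lemma poly_eq_scaled_tri_poly:
  fixes A B :: "complex poly" and H :: "nat \<Rightarrow> complex poly"
  assumes gen: "Abs_fps H * (1 + fps_const B * fps_X + fps_const A * fps_X ^ 4) = 1"
    and b: "poly B z \<noteq> 0"
  shows "poly (H m) z = (- poly B z) ^ m * poly (tri_poly m) (poly A z / poly B z ^ 4)"
proof -
  have "Abs_fps H * (1 + fps_const B * fps_X + fps_const A * fps_X ^ 4)
      = Abs_fps H + fps_const B * (Abs_fps H * fps_X) + fps_const A * (Abs_fps H * fps_X ^ 4)"
    by (simp add: algebra_simps)
  then have coeff: "H n + B * (if n = 0 then 0 else H (n - 1)) + A * (if n < 4 then 0 else H (n - 4))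
      = (if n = 0 then 1 else 0)" for n
    using arg_cong[OF gen, of "\<lambda>F. fps_nth F n"] by (simp add: fps_X_power_mult_right_nth cong: if_cong)
  have H_0: "H 0 = 1"
    using coeff[of 0] by simp
  have H_initial: "H (Suc n) = - (B * H n)" if "n < 3" for n
    using coeff[of "Suc n"] that by (simp add: eq_neg_iff_add_eq_0)
  have H_step: "H (n + 4) = - (B * H (n + 3)) - A * H n" for n
  proof -
    have "H (n + 4) + (B * H (n + 3) + A * H n) = 0"
      using coeff[of "n + 4"] by (simp add: add.assoc numeral_eq_Suc)
    then show ?thesis
      by algebra
  qed
  show ?thesis
  proof (induction m rule: recurrence_induct)
    case (initial m)
    then have "m = 0 \<or> m = 1 \<or> m = 2 \<or> m = 3"
      by linarith
    then show ?case
      using H_0 H_initial[of 0] H_initial[of 1] H_initial[of 2]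
      by (elim disjE) (simp_all add: tri_poly_initial power2_eq_square power3_eq_cube numeral_2_eq_2 numeral_3_eq_3)
  next
    case (step m)
    show ?case
      using b unfolding H_step tri_poly_step
      by (simp add: step field_simps power_add power4_eq_xxxx power3_eq_cube)
  qed
qed

text \<open>
  The quotients are the divided differences of \<open>x\<^sup>n\<close> at four nodes; those of a polynomial of
  degree below three vanish.  The proof clears the Vandermonde determinant \<open>V\<close>.
\<close>

lemma lagrange_power_sums:
  fixes a b d e :: "'a::field"
  assumes "a \<noteq> b" "a \<noteq> d" "a \<noteq> e" "b \<noteq> d" "b \<noteq> e" "d \<noteq> e"
  defines "T \<equiv> \<lambda>n. a ^ n / ((a - b) * (a - d) * (a - e)) + b ^ n / ((b - a) * (b - d) * (b - e))
                + d ^ n / ((d - a) * (d - b) * (d - e)) + e ^ n / ((e - a) * (e - b) * (e - d))"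
  shows "T 0 = 0" "T 1 = 0" "T 2 = 0" "T 3 = 1"
proof -
  define V where "V = (a - b) * (a - d) * (a - e) * (b - d) * (b - e) * (d - e)"
  have V: "V \<noteq> 0" using assms by (simp add: V_def)
  have inverse_complement: "1 / x = y / V" if "x * y = V" for x y
    using that V by (auto simp: field_simps)
  have i: "1 / ((a - b) * (a - d) * (a - e)) = (b - d) * (b - e) * (d - e) / V"
     "1 / ((b - a) * (b - d) * (b - e)) = - ((a - d) * (a - e) * (d - e)) / V"
     "1 / ((d - a) * (d - b) * (d - e)) = (a - b) * (a - e) * (b - e) / V"
     "1 / ((e - a) * (e - b) * (e - d)) = - ((a - b) * (a - d) * (b - d)) / V"
    by (rule inverse_complement; unfold V_def, algebra)+
  have T: "T n = (a ^ n * ((b - d) * (b - e) * (d - e)) - b ^ n * ((a - d) * (a - e) * (d - e))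
      + d ^ n * ((a - b) * (a - e) * (b - e)) - e ^ n * ((a - b) * (a - d) * (b - d))) / V" for n
  proof -
    have "T n = a ^ n * (1 / ((a - b) * (a - d) * (a - e))) + b ^ n * (1 / ((b - a) * (b - d) * (b - e)))
                + d ^ n * (1 / ((d - a) * (d - b) * (d - e))) + e ^ n * (1 / ((e - a) * (e - b) * (e - d)))"
      by (simp add: T_def)
    then show ?thesis unfolding i by (simp add: add_divide_distrib diff_divide_distrib)
  qed
  have "V = a ^ 3 * ((b - d) * (b - e) * (d - e)) - b ^ 3 * ((a - d) * (a - e) * (d - e))
      + d ^ 3 * ((a - b) * (a - e) * (b - e)) - e ^ 3 * ((a - b) * (a - d) * (b - d))"
    unfolding V_def by algebra
  then show "T 3 = 1" using V unfolding T by simp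
  have "0 = a ^ 2 * ((b - d) * (b - e) * (d - e)) - b ^ 2 * ((a - d) * (a - e) * (d - e))
      + d ^ 2 * ((a - b) * (a - e) * (b - e)) - e ^ 2 * ((a - b) * (a - d) * (b - d))"
    by algebra
  then show "T 2 = 0" unfolding T by simp
  have "0 = a * ((b - d) * (b - e) * (d - e)) - b * ((a - d) * (a - e) * (d - e))
      + d * ((a - b) * (a - e) * (b - e)) - e * ((a - b) * (a - d) * (b - d))"
    by algebra
  then show "T 1 = 0" unfolding T by simp
  have "0 = ((b - d) * (b - e) * (d - e)) - ((a - d) * (a - e) * (d - e))
      + ((a - b) * (a - e) * (b - e)) - ((a - b) * (a - d) * (b - d))"
    by algebra
  then show "T 0 = 0" unfolding T by simp
qed

text \<open>
  Partial fractions of \<open>1 / (1 - t + c t\<^sup>4)\<close>, written with the reciprocals \<open>a, b, d, e\<close> of the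
  roots, which are the roots of \<open>x\<^sup>4 - x\<^sup>3 + c\<close>.  Working with reciprocals turns the sum into the
  divided difference of \<open>x\<^bsup>m + 3\<^esup>\<close>: it satisfies the recurrence because each node does, and its
  values at the exponents 0 to 3 start the sequence.  The derivative \<open>4 x\<^sup>3 - 3 x\<^sup>2\<close> at a node is
  the product of the differences to the other nodes.
\<close>

lemma tri_poly_eq_residue_sum:
  fixes a b d e c :: "'a::field"
  assumes distinct: "a \<noteq> b" "a \<noteq> d" "a \<noteq> e" "b \<noteq> d" "b \<noteq> e" "d \<noteq> e"
    and c: "c \<noteq> 0"
    and vieta: "a + b + d + e = 1" "a * b + (a + b) * (d + e) + d * e = 0"
      "a * b * (d + e) + (a + b) * (d * e) = 0" "a * b * (d * e) = c"
  shows "poly (tri_poly m) c = a ^ (m + 1) / (4 * a - 3) + b ^ (m + 1) / (4 * b - 3)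
    + d ^ (m + 1) / (4 * d - 3) + e ^ (m + 1) / (4 * e - 3)"
proof -
  define T where "T = (\<lambda>n. a ^ n / ((a - b) * (a - d) * (a - e)) + b ^ n / ((b - a) * (b - d) * (b - e))
                + d ^ n / ((d - a) * (d - b) * (d - e)) + e ^ n / ((e - a) * (e - b) * (e - d)))"
  have T_initial: "T 0 = 0" "T 1 = 0" "T 2 = 0" "T 3 = 1"
    unfolding T_def using lagrange_power_sums[OF distinct] by blast+
  have root: "a ^ 4 = a ^ 3 - c" "b ^ 4 = b ^ 3 - c" "d ^ 4 = d ^ 3 - c" "e ^ 4 = e ^ 3 - c"
    using vieta by algebra+
  have T_step: "T (n + 4) = T (n + 3) - c * T n" for n
    unfolding T_def power_add root by (simp add: algebra_simps add_divide_distrib diff_divide_distrib)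
  have T4: "T 4 = 1" "T 5 = 1" "T 6 = 1"
    using T_step[of 0] T_step[of 1] T_step[of 2] T_initial by simp_all
  have T_tri: "poly (tri_poly m) c = T (m + 3)"
  proof (induction m rule: recurrence_induct)
    case (initial m)
    then have "m = 0 \<or> m = 1 \<or> m = 2 \<or> m = 3"
      by linarith
    then show ?case
      using T_initial T4 by (auto simp: tri_poly_initial)
  next
    case (step m)
    show ?case
      using T_step[of "m + 3"] by (simp add: tri_poly_step step add.commute)
  qed
  have deriv: "(a - b) * (a - d) * (a - e) = a ^ 2 * (4 * a - 3)" "(b - a) * (b - d) * (b - e) = b ^ 2 * (4 * b - 3)"
    "(d - a) * (d - b) * (d - e) = d ^ 2 * (4 * d - 3)" "(e - a) * (e - b) * (e - d) = e ^ 2 * (4 * e - 3)"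
    using vieta by algebra+
  have "a \<noteq> 0" "b \<noteq> 0" "d \<noteq> 0" "e \<noteq> 0"
    using c vieta(4) by auto
  then have "x ^ (m + 3) / (x ^ 2 * (4 * x - 3)) = x ^ (m + 1) / (4 * x - 3)" if "x \<in> {a, b, d, e}" for x
    using that by (auto simp: power_add power3_eq_cube power2_eq_square)
  then show ?thesis
    unfolding T_tri unfolding T_def deriv by simp
qed

section \<open>The roots of the normalised polynomials\<close>

text \<open>
  A pair \<open>\<rho> cis (\<plusminus> t)\<close> of conjugate roots of \<open>1 - s + c s\<^sup>4\<close> with \<open>0 < t < \<pi> / 4\<close> leaves a second
  pair of roots, and this is the square of the modulus of the second pair divided by that of the
  first: the coefficient of \<open>s\<^sup>2\<close> vanishes and the second pair has the opposite real part.
\<close>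

definition modulus_ratio :: "real \<Rightarrow> real" where
  "modulus_ratio t = 4 * (cos t)\<^sup>2 - 1"

text \<open>
  The number \<open>c\<close> for which \<open>1 - s + c s\<^sup>4\<close> has a root of argument \<open>t\<close>.  On the open interval from
  0 to \<open>\<pi> / 4\<close> it increases from \<open>27 / 256\<close>, where the pair merges into a double root, to infinity.
\<close>

definition ratio_at_angle :: "real \<Rightarrow> real" where
  "ratio_at_angle t = modulus_ratio t ^ 3 / ((modulus_ratio t + 1)\<^sup>2 * (modulus_ratio t - 1) ^ 4)"

text \<open>
  A positive multiple of \<open>4 - 3 s\<close>, the reciprocal of the residue weight at the root
  \<open>s = \<rho> cis (- t)\<close>.  Unlike \<open>4 - 3 s\<close> itself it does not vanish at \<open>t = 0\<close>, where \<open>s\<close> becomes a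
  double root; this makes \<open>phase\<close> continuous on the closed interval.
\<close>

definition residue_direction :: "real \<Rightarrow> complex" where
  "residue_direction t = Complex (sin t * (3 * modulus_ratio t + 1)) (3 * cos t * (modulus_ratio t - 1))"

definition phase :: "real \<Rightarrow> real" where
  "phase t = Arg (residue_direction t)"

lemma cos_sin_quarter:
  assumes "0 \<le> t" "t \<le> pi / 4"
  shows "0 < cos t" "1 / 2 \<le> (cos t)\<^sup>2" "0 \<le> sin t"
proof -
  show "0 < cos t"
    using assms pi_gt_zero by (intro cos_gt_zero_pi) linarith+
  have "cos (pi / 4) \<le> cos t"
    using assms pi_gt_zero by (intro cos_monotone_0_pi_le) linarith+
  then have "(cos (pi / 4))\<^sup>2 \<le> (cos t)\<^sup>2"
    by (intro power_mono cos_ge_zero) (use pi_gt_zero in linarith)+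
  then show "1 / 2 \<le> (cos t)\<^sup>2"
    by (simp add: cos_45 power_divide)
  show "0 \<le> sin t"
    using assms pi_gt_zero by (intro sin_ge_zero) linarith+
qed

lemma modulus_ratio_strict_antimono:
  assumes "0 \<le> s" "s < t" "t \<le> pi / 4"
  shows "modulus_ratio t < modulus_ratio s"
proof -
  have "cos t < cos s"
    using assms pi_gt_zero by (intro cos_monotone_0_pi) linarith+
  then have "(cos t)\<^sup>2 < (cos s)\<^sup>2"
    using cos_sin_quarter(1)[of t] assms by (intro power_strict_mono) linarith+
  then show ?thesis
    by (simp add: modulus_ratio_def)
qed

lemma modulus_ratio_endpoints: "modulus_ratio 0 = 3" "modulus_ratio (pi / 4) = 1"
  by (simp_all add: modulus_ratio_def cos_45 power_divide)

lemma modulus_ratio_bounds: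
  assumes "0 < t" "t < pi / 4"
  shows "1 < modulus_ratio t" "modulus_ratio t < 3"
  using modulus_ratio_strict_antimono[of t "pi / 4"] modulus_ratio_strict_antimono[of 0 t] assms modulus_ratio_endpoints
  by auto

lemma ratio_at_angle_pos: "0 < t \<Longrightarrow> t < pi / 4 \<Longrightarrow> 0 < ratio_at_angle t"
  using modulus_ratio_bounds[of t] by (simp add: ratio_at_angle_def)

lemma inverse_ratio_at_angle: "1 / ratio_at_angle t = (modulus_ratio t + 1)\<^sup>2 * (modulus_ratio t - 1) ^ 4 / modulus_ratio t ^ 3"
  by (simp add: ratio_at_angle_def)

text \<open>
  The factorisation of the quotient into \<open>(x + 1)\<^sup>2 (x - 1)\<close> and \<open>(1 - 1 / x)\<^sup>3\<close>, both nonnegative and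
  increasing for \<open>x \<ge> 1\<close>, makes monotonicity visible without derivatives.
\<close>

lemma resolvent_strict_mono:
  fixes u v :: real
  assumes "1 \<le> u" "u < v"
  shows "(u + 1)\<^sup>2 * (u - 1) ^ 4 / u ^ 3 < (v + 1)\<^sup>2 * (v - 1) ^ 4 / v ^ 3"
proof -
  have split: "(x + 1)\<^sup>2 * (x - 1) ^ 4 / x ^ 3 = ((x + 1)\<^sup>2 * (x - 1)) * (1 - 1 / x) ^ 3" if "1 \<le> x" for x :: real
  proof -
    have "1 - 1 / x = (x - 1) / x"
      using that by (simp add: field_simps)
    then show ?thesis
      by (simp add: power_divide power4_eq_xxxx power3_eq_cube)
  qed
  have "(u + 1)\<^sup>2 * (u - 1) < (v + 1)\<^sup>2 * (v - 1)"
    using assms by (intro mult_le_less_imp_less power_mono) auto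
  moreover have "(1 - 1 / u) ^ 3 < (1 - 1 / v) ^ 3"
    using assms by (intro power_strict_mono) (auto simp: field_simps)
  ultimately show ?thesis
    using assms by (simp only: split) (rule mult_strict_mono'; simp)
qed

lemma ratio_at_angle_strict_mono:
  assumes "0 < s" "s < t" "t < pi / 4"
  shows "ratio_at_angle s < ratio_at_angle t"
proof -
  have "1 / ratio_at_angle t < 1 / ratio_at_angle s"
    unfolding inverse_ratio_at_angle
    using assms modulus_ratio_bounds[of t] by (intro resolvent_strict_mono modulus_ratio_strict_antimono) auto
  then show ?thesis
    using ratio_at_angle_pos[of s] ratio_at_angle_pos[of t] assms by (simp add: field_simps)
qed

lemma ratio_at_angle_gt:
  assumes "0 < t" "t < pi / 4"
  shows "27 / 256 < ratio_at_angle t"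
proof -
  have "1 / ratio_at_angle t < 256 / 27"
    unfolding inverse_ratio_at_angle using resolvent_strict_mono[of "modulus_ratio t" 3] modulus_ratio_bounds[OF assms] by simp
  then show ?thesis
    using ratio_at_angle_pos[OF assms] by (simp add: field_simps)
qed

lemma ratio_at_angle_surj:
  assumes "27 / 256 < c"
  obtains t where "0 < t" "t < pi / 4" "ratio_at_angle t = c"
proof -
  define g where "g = (\<lambda>u::real. (u + 1)\<^sup>2 * (u - 1) ^ 4 / u ^ 3)"
  have "continuous_on {0..pi / 4} (\<lambda>t. g (modulus_ratio t))"
  proof -
    have "modulus_ratio t \<noteq> 0" if "t \<in> {0..pi / 4}" for t
      using cos_sin_quarter(2)[of t] that by (auto simp: modulus_ratio_def)
    then show ?thesis
      unfolding g_def modulus_ratio_def by (intro continuous_intros) auto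
  qed
  moreover have "g (modulus_ratio (pi / 4)) \<le> 1 / c" "1 / c \<le> g (modulus_ratio 0)"
    using assms by (simp_all add: modulus_ratio_endpoints g_def field_simps)
  ultimately obtain t where t: "0 \<le> t" "t \<le> pi / 4" "g (modulus_ratio t) = 1 / c"
    using IVT2'[of "\<lambda>t. g (modulus_ratio t)" "pi / 4" "1 / c" 0] by auto
  have "g (modulus_ratio 0) \<noteq> 1 / c" "g (modulus_ratio (pi / 4)) \<noteq> 1 / c"
    using assms by (auto simp: modulus_ratio_endpoints g_def field_simps)
  then have "t \<noteq> 0" "t \<noteq> pi / 4"
    using t(3) by (auto simp only:)
  with t(1,2) have "0 < t" "t < pi / 4"
    by linarith+
  moreover have "1 / ratio_at_angle t = 1 / c"
    using t(3) by (simp add: inverse_ratio_at_angle g_def)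
  then have "ratio_at_angle t = c"
    by simp
  ultimately show ?thesis
    by (rule that)
qed

lemma residue_direction_coords:
  assumes "0 \<le> t" "t \<le> pi / 4"
  shows "0 \<le> Re (residue_direction t)" "0 \<le> Im (residue_direction t)" "residue_direction t \<noteq> 0"
proof -
  note cs = cos_sin_quarter[OF assms]
  have w: "1 \<le> modulus_ratio t"
    using cs by (simp add: modulus_ratio_def)
  then show re: "0 \<le> Re (residue_direction t)" and im: "0 \<le> Im (residue_direction t)"
    using cs by (simp_all add: residue_direction_def)
  show "residue_direction t \<noteq> 0"
  proof
    assume "residue_direction t = 0"
    then have "sin t = 0" "modulus_ratio t = 1"
      using cs w by (auto simp: residue_direction_def complex_eq_iff)
    then show False
      using sin_cos_squared_add[of t] by (simp add: modulus_ratio_def)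
  qed
qed

lemma phase_bounds:
  assumes "0 \<le> t" "t \<le> pi / 4"
  shows "0 \<le> phase t" "phase t \<le> pi / 2"
  using residue_direction_coords[OF assms] Re_Ln_pos_le[of "residue_direction t"]
  by (auto simp: phase_def Arg_less_0) (auto simp: Arg_def)

lemma phase_endpoints: "phase 0 = pi / 2" "phase (pi / 4) = 0"
proof -
  have "residue_direction 0 = of_real 6 * \<i>"
    by (simp add: residue_direction_def modulus_ratio_endpoints complex_eq_iff)
  then show "phase 0 = pi / 2"
    unfolding phase_def by (simp only: Arg_times_of_real) simp
  have "residue_direction (pi / 4) = of_real (sin (pi / 4) * 4)"
    by (simp add: residue_direction_def modulus_ratio_endpoints complex_eq_iff)
  then show "phase (pi / 4) = 0"
    unfolding phase_def by (simp only: Arg_of_real) (simp add: sin_45)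
qed

lemma continuous_on_phase: "continuous_on {0..pi / 4} phase"
proof -
  have "residue_direction t \<notin> \<real>\<^sub>\<le>\<^sub>0" if "t \<in> {0..pi / 4}" for t
    using residue_direction_coords[of t] that
    by (auto simp: complex_nonpos_Reals_iff complex_eq_iff)
  then show ?thesis
    unfolding phase_def
    by (intro continuous_on_Arg')
       (auto simp: residue_direction_def modulus_ratio_def Complex_eq intro!: continuous_intros)
qed

text \<open>
  In the residue sum, the two dominant terms add up to \<open>2 r\<^sup>m / R\<close> times the cosine of
  \<open>m t - phase t\<close>, which is \<open>(-1)\<^sup>k\<close> here.  The other two terms are strictly smaller for every \<open>m\<close>:
  their roots \<open>1 / y\<close> are farther from 0 and lie in the left half plane, so both the power and the
  weight \<open>1 / (4 - 3 / y)\<close> are dominated.  No asymptotics in \<open>m\<close> is involved, so the signs can be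
  used to count all roots.
\<close>

lemma sign_at_phase:
  assumes t: "0 < t" "t < pi / 4" and k: "real m * t - phase t = real k * pi"
  shows "0 < (-1) ^ k * poly (tri_poly m) (ratio_at_angle t)"
proof -
  define C S w where "C = cos t" and "S = sin t" and "w = modulus_ratio t"
  define r where "r = w / (2 * C * (w - 1))"
  have C: "0 < C" and S: "0 < S"
    using cos_sin_quarter(1)[of t] sin_gt_zero[of t] t pi_gt_zero by (auto simp: C_def S_def)
  have w: "1 < w" "w < 3" and C2: "4 * C\<^sup>2 = w + 1" and S2: "4 * S\<^sup>2 = 3 - w"
    using modulus_ratio_bounds[OF t] sin_squared_eq[of t] by (auto simp: w_def modulus_ratio_def C_def S_def)
  have r: "0 < r" and r_eq: "2 * r * C * (w - 1) = w"
    using C w by (simp_all add: r_def field_simps)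
  have c: "ratio_at_angle t = r ^ 4 / w"
  proof -
    have "(2 * C) ^ 4 = (w + 1)\<^sup>2"
      using arg_cong[OF C2, of "\<lambda>x. x\<^sup>2"] by (simp add: power_mult_distrib)
    then have "r ^ 4 = w ^ 4 / ((w + 1)\<^sup>2 * (w - 1) ^ 4)"
      by (simp add: r_def power_divide power_mult_distrib)
    then show ?thesis
      using w by (simp add: ratio_at_angle_def w_def[symmetric] power4_eq_xxxx power3_eq_cube)
  qed
  define d where "d = sqrt (3 * C\<^sup>2 - 1)"
  have d: "0 < d" "C\<^sup>2 + d\<^sup>2 = w"
    using C2 w by (auto simp: d_def)
  \<comment> \<open>Reciprocals of the four roots: x and its conjugate (dominant), y and its conjugate.\<close>
  define x where "x = of_real r * cis t"
  define y where "y = of_real (r / w) * Complex (- C) d"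
  have x_coords: "Re x = r * C" "Im x = r * S"
    by (simp_all add: x_def C_def S_def)
  have y_coords: "Re y = - (r / w * C)" "Im y = r / w * d"
    by (simp_all add: y_def)
  have C_pos: "0 < r * C" "0 < r * S" "0 < r / w * C" "0 < r / w * d"
    using r C S d w by auto
  have distinct: "x \<noteq> cnj x" "x \<noteq> y" "x \<noteq> cnj y" "cnj x \<noteq> y" "cnj x \<noteq> cnj y" "y \<noteq> cnj y"
    using C_pos by (auto simp: complex_eq_iff x_coords y_coords)
  have x_sum: "x + cnj x = of_real (2 * r * C)" and y_sum: "y + cnj y = of_real (- (2 * r * C / w))"
    by (simp_all add: complex_eq_iff x_coords y_coords)
  have x_prod: "x * cnj x = of_real (r\<^sup>2)" and y_prod: "y * cnj y = of_real (r\<^sup>2 / w)"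
  proof -
    have "(r * C)\<^sup>2 + (r * S)\<^sup>2 = r\<^sup>2"
      by (simp add: power_mult_distrib C_def S_def flip: distrib_left)
    then show "x * cnj x = of_real (r\<^sup>2)"
      by (simp add: complex_mult_cnj x_coords)
    have "(r / w * C)\<^sup>2 + (r / w * d)\<^sup>2 = (r / w)\<^sup>2 * w"
      using d(2) by (simp only: power_mult_distrib flip: distrib_left)
    also have "\<dots> = r\<^sup>2 / w"
      using w by (simp add: power_divide power2_eq_square)
    finally show "y * cnj y = of_real (r\<^sup>2 / w)"
      by (simp add: complex_mult_cnj y_coords)
  qed
  have vieta: "2 * r * C - 2 * r * C / w = 1" "r\<^sup>2 - (2 * r * C) * (2 * r * C / w) + r\<^sup>2 / w = 0"
    "r\<^sup>2 * (- (2 * r * C / w)) + 2 * r * C * (r\<^sup>2 / w) = 0" "r\<^sup>2 * (r\<^sup>2 / w) = ratio_at_angle t"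
  proof -
    show "2 * r * C - 2 * r * C / w = 1"
      using r_eq w by (simp add: field_simps)
    have "r\<^sup>2 - (2 * r * C) * (2 * r * C / w) + r\<^sup>2 / w = r\<^sup>2 * (w + 1 - 4 * C\<^sup>2) / w"
      using w by (simp add: field_simps power2_eq_square)
    then show "r\<^sup>2 - (2 * r * C) * (2 * r * C / w) + r\<^sup>2 / w = 0"
      using C2 by simp
  qed (simp_all add: c)
  have sum: "poly (tri_poly m) (of_real (ratio_at_angle t)) = x ^ (m + 1) / (4 * x - 3) + cnj x ^ (m + 1) / (4 * cnj x - 3)
      + y ^ (m + 1) / (4 * y - 3) + cnj y ^ (m + 1) / (4 * cnj y - 3)"
  proof (rule tri_poly_eq_residue_sum[OF distinct])
    show "complex_of_real (ratio_at_angle t) \<noteq> 0"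
      using ratio_at_angle_pos[OF t] by simp
    have "x + cnj x + y + cnj y = of_real (2 * r * C - 2 * r * C / w)"
      by (simp only: x_sum add.assoc y_sum flip: of_real_add) simp
    then show "x + cnj x + y + cnj y = 1"
      unfolding vieta by simp
    show "x * cnj x + (x + cnj x) * (y + cnj y) + y * cnj y = 0"
      unfolding x_sum y_sum x_prod y_prod using vieta(2)
      by (simp only: of_real_eq_0_iff flip: of_real_add of_real_mult)
    show "x * cnj x * (y + cnj y) + (x + cnj x) * (y * cnj y) = 0"
      unfolding x_sum y_sum x_prod y_prod using vieta(3)
      by (simp only: of_real_eq_0_iff flip: of_real_add of_real_mult)
    show "x * cnj x * (y * cnj y) = of_real (ratio_at_angle t)"
      unfolding x_prod y_prod using vieta(4) by (simp only: flip: of_real_mult)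
  qed
  have conj: "cnj z ^ (m + 1) / (4 * cnj z - 3) = cnj (z ^ (m + 1) / (4 * z - 3))" for z
    by simp
  have "complex_of_real (poly (tri_poly m) (ratio_at_angle t))
      = of_real (2 * Re (x ^ (m + 1) / (4 * x - 3)) + 2 * Re (y ^ (m + 1) / (4 * y - 3)))"
    unfolding poly_tri_poly_of_real[symmetric] sum conj add.assoc complex_add_cnj
    by (simp only: complex_add_cnj of_real_add flip: add.assoc)
  then have P: "poly (tri_poly m) (ratio_at_angle t)
      = 2 * Re (x ^ (m + 1) / (4 * x - 3)) + 2 * Re (y ^ (m + 1) / (4 * y - 3))"
    by (simp only: of_real_eq_iff)
  have x0: "x \<noteq> 0" and y0: "y \<noteq> 0"
    using C_pos by (auto simp: complex_eq_iff x_coords y_coords)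
  have quotient: "z ^ (m + 1) / (4 * z - 3) = z ^ m / (4 - 3 / z)" if "z \<noteq> 0" for z :: complex
    using that by (simp add: field_simps)
  have CS: "C\<^sup>2 + S\<^sup>2 = 1"
    by (simp add: C_def S_def)
  have conj_prod: "Complex u v * Complex u (- v) = of_real (u\<^sup>2 + v\<^sup>2)" for u v
    by (simp add: complex_eq_iff power2_eq_square)
  \<comment> \<open>The coordinates of the roots themselves, to compare 4 - 3 / x with 4 - 3 / y.\<close>
  have inv_x: "1 / x = of_real (1 / r) * Complex C (- S)"
  proof -
    have "x = of_real r * Complex C S"
      by (simp add: complex_eq_iff x_coords)
    then have "x * (of_real (1 / r) * Complex C (- S)) = of_real (r * (1 / r)) * (Complex C S * Complex C (- S))"
      by (simp only: of_real_mult mult_ac)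
    also have "\<dots> = 1"
      unfolding conj_prod CS using r by simp
    finally show ?thesis
      by (metis inverse_eq_divide inverse_unique)
  qed
  have inv_y: "1 / y = of_real (1 / r) * Complex (- C) (- d)"
  proof -
    have "y * (of_real (1 / r) * Complex (- C) (- d))
        = of_real (r / w * (1 / r)) * (Complex (- C) d * Complex (- C) (- d))"
      unfolding y_def by (simp only: of_real_mult mult_ac)
    also have "\<dots> = 1"
      unfolding conj_prod power2_minus d(2) using r w by simp
    finally show ?thesis
      by (metis inverse_eq_divide inverse_unique)
  qed
  have coords_x: "4 - 3 / x = Complex (4 - 3 * C / r) (3 * S / r)"
  proof -
    have "4 - 3 / x = 4 - 3 * (1 / x)"
      by simp
    then show ?thesis
      unfolding inv_x by (simp add: complex_eq_iff)
  qed
  have coords_y: "4 - 3 / y = Complex (4 + 3 * C / r) (3 * d / r)"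
  proof -
    have "4 - 3 / y = 4 - 3 * (1 / y)"
      by simp
    then show ?thesis
      unfolding inv_y by (simp add: complex_eq_iff)
  qed
  define R where "R = norm (4 - 3 / x)"
  have "4 - 3 / x = of_real (2 * S / w) * residue_direction t"
  proof -
    have inv_r: "3 * u / r = 6 * C * (w - 1) / w * u" for u
      using w C by (simp add: r_def)
    have "4 - 6 * C * (w - 1) / w * C = 2 * S / w * (S * (3 * w + 1))"
    proof -
      have "4 * w - 6 * C\<^sup>2 * (w - 1) = 2 * S\<^sup>2 * (3 * w + 1)"
        using C2 S2 by algebra
      then show ?thesis
        using w by (simp add: field_simps power2_eq_square)
    qed
    moreover have "6 * C * (w - 1) / w * S = 2 * S / w * (3 * C * (w - 1))"
      by simp
    moreover have "residue_direction t = Complex (S * (3 * w + 1)) (3 * C * (w - 1))"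
      by (simp add: residue_direction_def w_def C_def S_def)
    ultimately show ?thesis
      unfolding coords_x inv_r by (simp add: complex_eq_iff)
  qed
  then have "Arg (4 - 3 / x) = phase t" and x_ne: "4 - 3 / x \<noteq> 0"
    using S w residue_direction_coords[of t] t by (auto simp: phase_def Arg_times_of_real simp del: of_real_divide of_real_mult)
  then have R: "0 < R" "4 - 3 / x = of_real R * cis (phase t)"
    using rcis_cmod_Arg[of "4 - 3 / x"] by (auto simp: R_def rcis_def)
  have "x ^ m = of_real (r ^ m) * cis (real m * t)"
    by (simp add: x_def power_mult_distrib Complex.DeMoivre)
  then have "x ^ m / (4 - 3 / x) = of_real (r ^ m / R) * cis (real m * t - phase t)"
    unfolding R(2) cis_divide[symmetric] by simp
  then have main: "Re (x ^ m / (4 - 3 / x)) = r ^ m / R * (-1) ^ k"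
    unfolding k by (simp add: cos_npi)
  have "R < norm (4 - 3 / y)"
  proof -
    have "R\<^sup>2 = (4 - 3 * C / r)\<^sup>2 + (3 * S / r)\<^sup>2"
      unfolding R_def cmod_power2 coords_x by simp
    also have "\<dots> = 16 - 24 * (C / r) + 9 / r\<^sup>2 * (C\<^sup>2 + S\<^sup>2)"
      by (simp add: power2_eq_square algebra_simps add_divide_distrib)
    also have "\<dots> < 16 + 24 * (C / r) + 9 / r\<^sup>2 * (C\<^sup>2 + d\<^sup>2)"
    proof -
      have "9 / r\<^sup>2 * (C\<^sup>2 + S\<^sup>2) \<le> 9 / r\<^sup>2 * (C\<^sup>2 + d\<^sup>2)"
        using d(2) w by (intro mult_left_mono) (simp_all add: C_def S_def)
      moreover have "0 < C / r"
        using C r by simp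
      ultimately show ?thesis
        by linarith
    qed
    also have "\<dots> = (4 + 3 * C / r)\<^sup>2 + (3 * d / r)\<^sup>2"
      by (simp add: power2_eq_square algebra_simps add_divide_distrib)
    also have "\<dots> = (norm (4 - 3 / y))\<^sup>2"
      unfolding cmod_power2 coords_y by simp
    finally show ?thesis
      by (rule power2_less_imp_less) simp
  qed
  moreover have "norm y \<le> r"
  proof -
    have "(norm y)\<^sup>2 = r\<^sup>2 / w"
      using y_prod by (simp only: complex_norm_square[symmetric] of_real_eq_iff)
    also have "\<dots> \<le> r\<^sup>2"
      using w mult_right_mono[of 1 w "r\<^sup>2"] by (simp add: field_simps)
    finally show ?thesis
      by (rule power2_le_imp_le) (use r in simp)
  qed
  ultimately have "norm (y ^ m / (4 - 3 / y)) < r ^ m / R"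
    unfolding norm_divide norm_power using r R y0
    by (intro frac_less2 power_mono) auto
  then have small: "\<bar>Re (y ^ m / (4 - 3 / y))\<bar> < r ^ m / R"
    by (meson abs_Re_le_cmod le_less_trans)
  have "(-1) ^ k * poly (tri_poly m) (ratio_at_angle t)
      = 2 * (r ^ m / R) + 2 * ((-1) ^ k * Re (y ^ m / (4 - 3 / y)))"
    unfolding P quotient[OF x0] quotient[OF y0] main
    by (simp add: algebra_simps flip: power_mult_distrib)
  moreover have "\<bar>(-1) ^ k * Re (y ^ m / (4 - 3 / y))\<bar> < r ^ m / R"
    using small by (simp add: abs_mult)
  ultimately show ?thesis
    by linarith
qed

lemma phase_level:
  assumes "0 \<le> s" "s < t" "t \<le> pi / 4"
    and "real m * s - phase s < y" "y < real m * t - phase t"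
  obtains u where "s < u" "u < t" "real m * u - phase u = y"
proof -
  have "continuous_on {s..t} (\<lambda>u. real m * u - phase u)"
    using assms by (intro continuous_intros continuous_on_subset[OF continuous_on_phase]) auto
  then obtain u where u: "s \<le> u" "u \<le> t" "real m * u - phase u = y"
    using IVT'[of "\<lambda>u. real m * u - phase u" s y t] assms by auto
  with assms(4,5) have "u \<noteq> s" "u \<noteq> t"
    by auto
  with u show ?thesis
    by (intro that[of u]) auto
qed

lemma root_between_phase_levels:
  assumes "0 < s" "s < t" "t < pi / 4"
    and "real m * s - phase s = real k * pi" "real m * t - phase t = real (Suc k) * pi"
  obtains x where "ratio_at_angle s < x" "x < ratio_at_angle t" "poly (tri_poly m) x = 0"
proof -
  have "0 < ((-1) ^ k * poly (tri_poly m) (ratio_at_angle s)) * ((-1) ^ Suc k * poly (tri_poly m) (ratio_at_angle t))"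
    using assms by (intro mult_pos_pos sign_at_phase) auto
  also have "\<dots> = - (poly (tri_poly m) (ratio_at_angle s) * poly (tri_poly m) (ratio_at_angle t))"
    by (simp add: algebra_simps flip: power_mult_distrib)
  finally show ?thesis
    using poly_IVT[of "ratio_at_angle s" "ratio_at_angle t" "tri_poly m"] ratio_at_angle_strict_mono[OF assms(1-3)] that by auto
qed

lemma finite_tri_roots: "finite {x. poly (tri_poly m) x = (0 :: 'a::idom)}"
  using tri_poly_nonzero by (rule poly_roots_finite)

text \<open>
  The function \<open>m t - phase t\<close> goes from \<open>- \<pi> / 2\<close> to \<open>m \<pi> / 4\<close>, hence takes each value \<open>k \<pi>\<close>
  with \<open>0 \<le> 4 k < m\<close>.  The next level is looked for to the right of the previous one,
  so that the roots found in between are distinct.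
\<close>

lemma many_roots_below_level:
  assumes "4 * k < m"
  shows "\<exists>t. 0 < t \<and> t < pi / 4 \<and> real m * t - phase t = real k * pi
    \<and> k \<le> card {x. 27 / 256 < x \<and> x < ratio_at_angle t \<and> poly (tri_poly m) x = 0}"
  using assms
proof (induction k)
  case 0
  then obtain t where "0 < t" "t < pi / 4" "real m * t - phase t = 0"
    using phase_level[of 0 "pi / 4" m 0] by (auto simp: phase_endpoints)
  then show ?case
    by auto
next
  case (Suc k)
  then obtain s where s: "0 < s" "s < pi / 4" "real m * s - phase s = real k * pi"
    and card: "k \<le> card {x. 27 / 256 < x \<and> x < ratio_at_angle s \<and> poly (tri_poly m) x = 0}"
    by auto
  have "4 * real (Suc k) < real m"
    using Suc.prems by linarith
  from mult_strict_right_mono[OF this pi_gt_zero]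
  have "real (Suc k) * pi < real m * (pi / 4)"
    by simp
  then obtain t where t: "s < t" "t < pi / 4" "real m * t - phase t = real (Suc k) * pi"
    using phase_level[of s "pi / 4" m "real (Suc k) * pi"] s by (auto simp: phase_endpoints)
  obtain x where x: "ratio_at_angle s < x" "x < ratio_at_angle t" "poly (tri_poly m) x = 0"
    using root_between_phase_levels[OF s(1) t(1,2) s(3) t(3)] .
  let ?S = "{x. 27 / 256 < x \<and> x < ratio_at_angle s \<and> poly (tri_poly m) x = 0}"
  let ?T = "{x. 27 / 256 < x \<and> x < ratio_at_angle t \<and> poly (tri_poly m) x = 0}"
  have fin: "finite ?S" "finite ?T"
    by (rule finite_subset[OF _ finite_tri_roots[of m]], blast)+
  have "insert x ?S \<subseteq> ?T"
    using x ratio_at_angle_gt[OF s(1,2)] ratio_at_angle_strict_mono[OF s(1) t(1,2)] by auto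
  with fin(2) have "card (insert x ?S) \<le> card ?T"
    by (rule card_mono)
  moreover have "card (insert x ?S) = Suc (card ?S)"
    using fin(1) x(1) by (intro card_insert_disjoint) auto
  ultimately have "Suc k \<le> card ?T"
    using card by linarith
  with s t show ?case
    by (intro exI[of _ t]) auto
qed

text \<open>
  If 4 does not divide \<open>m\<close>, the sign changes between consecutive phase levels already give as many
  roots as the degree allows.  If \<open>m = 4 (n + 1)\<close>, they give \<open>n\<close> of them, and the sign of the leading
  coefficient yields one more beyond the last level.
\<close>

lemma card_real_roots:
  "m div 4 \<le> card {x::real. 27 / 256 < x \<and> poly (tri_poly m) x = 0}"
proof (cases "4 * (m div 4) < m")
  case True
  from many_roots_below_level[OF this] obtain t
    where "m div 4 \<le> card {x. 27 / 256 < x \<and> x < ratio_at_angle t \<and> poly (tri_poly m) x = 0}"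
    by auto
  also have "\<dots> \<le> card {x::real. 27 / 256 < x \<and> poly (tri_poly m) x = 0}"
    by (intro card_mono finite_subset[OF _ finite_tri_roots[of m]]) auto
  finally show ?thesis .
next
  case False
  then have m: "m = 4 * (m div 4)"
    by (simp add: le_antisym)
  show ?thesis
  proof (cases "m div 4")
    case (Suc n)
    then have m: "m = 4 * Suc n" and "4 * n < m"
      using m by auto
    from many_roots_below_level[OF this(2)] obtain t where t: "0 < t" "t < pi / 4"
        "real m * t - phase t = real n * pi"
      and card: "n \<le> card {x. 27 / 256 < x \<and> x < ratio_at_angle t \<and> poly (tri_poly m) x = 0}"
      by auto
    define p where "p = smult ((-1) ^ Suc n) (tri_poly m :: real poly)"
    have coeff: "coeff p (Suc n) = 1"
      unfolding p_def m coeff_smult coeff_tri_poly_top by (simp flip: power_mult_distrib)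
    then have "degree p = Suc n"
      using le_degree[of p "Suc n"] degree_tri_poly[of m, where 'a = real] Suc by (simp add: p_def)
    then obtain y where "\<And>x. y \<le> x \<Longrightarrow> 1 \<le> poly p x"
      using poly_pinfty_gt_lc[of p] coeff by auto
    then have y: "ratio_at_angle t < max y (ratio_at_angle t + 1)" "0 < poly p (max y (ratio_at_angle t + 1))"
      by (auto intro: less_le_trans[of 0 1])
    have "0 < (-1) ^ n * poly (tri_poly m) (ratio_at_angle t)"
      by (rule sign_at_phase[OF t])
    then have "poly p (ratio_at_angle t) < 0"
      by (simp add: p_def)
    then obtain x where x: "ratio_at_angle t < x" "poly p x = 0"
      using poly_IVT_pos[OF y(1) _ y(2)] by blast
    let ?S = "{x. 27 / 256 < x \<and> x < ratio_at_angle t \<and> poly (tri_poly m) x = 0}"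
    have fin: "finite ?S" "finite {x::real. 27 / 256 < x \<and> poly (tri_poly m) x = 0}"
      by (rule finite_subset[OF _ finite_tri_roots[of m]], blast)+
    have "insert x ?S \<subseteq> {x. 27 / 256 < x \<and> poly (tri_poly m) x = 0}"
      using x ratio_at_angle_gt[OF t(1,2)] by (auto simp: p_def)
    with fin have "card (insert x ?S) \<le> card {x::real. 27 / 256 < x \<and> poly (tri_poly m) x = 0}"
      by (intro card_mono)
    moreover have "card (insert x ?S) = Suc (card ?S)"
      using fin x(1) by (intro card_insert_disjoint) auto
    ultimately show ?thesis
      using card Suc by simp
  qed simp
qed

text \<open>
  The degree leaves no room for roots other than those counted in \<open>card_real_roots\<close>.
\<close>

lemma tri_poly_roots_real:
  fixes c :: complex
  assumes "poly (tri_poly m) c = 0"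
  obtains x where "c = of_real x" "27 / 256 < x" "poly (tri_poly m) x = 0"
proof -
  let ?S = "{x::real. 27 / 256 < x \<and> poly (tri_poly m) x = 0}"
  let ?R = "{c::complex. poly (tri_poly m) c = 0}"
  have "of_real ` ?S \<subseteq> ?R"
    by (auto simp: poly_tri_poly_of_real)
  moreover have "card ?R \<le> card (complex_of_real ` ?S)"
  proof -
    have "card ?R \<le> degree (tri_poly m :: complex poly)"
      by (intro card_poly_roots_bound tri_poly_nonzero)
    also have "\<dots> \<le> m div 4"
      by (rule degree_tri_poly)
    also have "\<dots> \<le> card ?S"
      by (rule card_real_roots)
    also have "\<dots> = card (complex_of_real ` ?S)"
      by (intro card_image[symmetric] inj_onI) simp
    finally show ?thesis .
  qed
  ultimately have "of_real ` ?S = ?R"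
    using finite_tri_roots by (intro card_seteq) auto
  then show ?thesis
    using assms that by blast
qed

text \<open>
  On a fixed interval of angles the function \<open>m t - phase t\<close> gains at least \<open>3 \<pi>\<close> once \<open>m\<close> is
  large, so the interval contains two consecutive phase levels and a root in between.
\<close>

lemma tri_poly_roots_dense:
  assumes "27 / 256 < lo" "lo < hi"
  shows "\<forall>\<^sub>F m in sequentially. \<exists>x. lo < x \<and> x < hi \<and> poly (tri_poly m) x = (0::real)"
proof -
  obtain t1 where t1: "0 < t1" "t1 < pi / 4" "ratio_at_angle t1 = lo"
    using ratio_at_angle_surj[OF assms(1)] .
  obtain t2 where t2: "0 < t2" "t2 < pi / 4" "ratio_at_angle t2 = hi"
    using ratio_at_angle_surj[of hi] assms by auto
  have "t1 < t2"
    using ratio_at_angle_strict_mono[of t2 t1] t1 t2 assms(2) by (cases t1 t2 rule: linorder_cases) auto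
  have "\<forall>\<^sub>F m in sequentially. 4 * pi / (t2 - t1) \<le> real m"
    using filterlim_real_sequentially by (simp add: filterlim_at_top)
  then show ?thesis
  proof eventually_elim
    case (elim m)
    define f where "f = (\<lambda>t. real m * t - phase t)"
    have "0 \<le> real m * t1"
      using t1 by simp
    then have f1: "- pi \<le> f t1"
      using phase_bounds[of t1] t1 pi_gt_zero unfolding f_def by linarith
    have gap: "f t1 + 3 * pi \<le> f t2"
    proof -
      have "4 * pi \<le> real m * (t2 - t1)"
        using elim \<open>t1 < t2\<close> by (simp add: field_simps)
      then show ?thesis
        using phase_bounds[of t1] phase_bounds[of t2] t1 t2 pi_gt_zero
        by (simp add: f_def algebra_simps)
    qed
    define k where "k = nat (\<lfloor>f t1 / pi\<rfloor> + 1)"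
    have "- 1 \<le> f t1 / pi"
      using f1 pi_gt_zero by (simp add: field_simps)
    then have "- 1 \<le> \<lfloor>f t1 / pi\<rfloor>"
      by (simp add: le_floor_iff)
    then have "real k = \<lfloor>f t1 / pi\<rfloor> + 1"
      by (simp add: k_def)
    then have "f t1 / pi < real k" "real k \<le> f t1 / pi + 1"
      by linarith+
    then have k: "f t1 < real k * pi" "real k * pi \<le> f t1 + pi"
      by (simp_all add: field_simps)
    obtain s1 where s1: "t1 < s1" "s1 < t2" "f s1 = real k * pi"
      using phase_level[of t1 t2 m "real k * pi"] t1 t2 \<open>t1 < t2\<close> k gap pi_gt_zero
      by (auto simp: f_def)
    obtain s2 where s2: "s1 < s2" "s2 < t2" "f s2 = real (Suc k) * pi"
      using phase_level[of s1 t2 m "real (Suc k) * pi"] t1 t2 s1 k gap pi_gt_zero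
      by (auto simp: f_def algebra_simps)
    obtain x where "ratio_at_angle s1 < x" "x < ratio_at_angle s2" "poly (tri_poly m) x = 0"
      using root_between_phase_levels[of s1 s2 m k] t1 t2 s1 s2 by (auto simp: f_def)
    moreover have "ratio_at_angle t1 < ratio_at_angle s1" "ratio_at_angle s2 < ratio_at_angle t2"
      using t1 t2 s1 s2 by (auto intro!: ratio_at_angle_strict_mono)
    ultimately show ?case
      using t1(3) t2(3) by (intro exI[of _ x]) auto
  qed
qed

section \<open>Quotients of roots\<close>

text \<open>
  The equation says that \<open>u\<close> is a root of the real quadratic \<open>u\<^sup>2 - x u + 1\<close>, whose roots are
  conjugate with product 1 when the discriminant is not positive.
\<close>

lemma joukowski_unit:
  fixes u :: complex
  assumes "u \<noteq> 0" "u + 1 / u = of_real x" "\<bar>x\<bar> \<le> 2"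
  shows "cmod u = 1"
proof -
  define a b where "a = Re u" and "b = Im u"
  have "u\<^sup>2 + 1 = of_real x * u"
    using assms(1,2) by (simp add: field_simps power2_eq_square)
  then have re: "a\<^sup>2 - b\<^sup>2 + 1 = x * a" and im: "2 * a * b = x * b"
    by (simp_all add: complex_eq_iff a_def b_def power2_eq_square)
  have "x\<^sup>2 \<le> 4"
    using power_mono[OF assms(3), of 2] by simp
  have "2 * a = x"
  proof (cases "b = 0")
    case True
    then have "(2 * a - x)\<^sup>2 = x\<^sup>2 - 4"
      using re by algebra
    with \<open>x\<^sup>2 \<le> 4\<close> have "(2 * a - x)\<^sup>2 = 0"
      using zero_le_power2[of "2 * a - x"] by linarith
    then show ?thesis
      by simp
  qed (use im in simp)
  then have "a\<^sup>2 + b\<^sup>2 = 1"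
    using re by (simp add: power2_eq_square flip: \<open>2 * a = x\<close>)
  then show ?thesis
    by (simp add: cmod_def a_def b_def)
qed

text \<open>
  Of the twelve quotients of two distinct roots of \<open>1 - s + c s\<^sup>4\<close>, the four that come from the two
  halves of a splitting of the roots into pairs have the same image under this function.  There are
  three such splittings, and the three images are the roots of a resolvent cubic.
\<close>

definition resolvent_var :: "complex \<Rightarrow> complex" where
  "resolvent_var q = (let w = q + 1 + 1 / q in w + 1 / w)"

lemma inverse_of_unit: "cmod u = 1 \<Longrightarrow> 1 / u = cnj u"
  by (simp add: divide_conv_cnj)

lemma mult_shift_inverse: "q \<noteq> 0 \<Longrightarrow> q * (q + 1 + 1 / q) = q\<^sup>2 + q + 1" for q :: complex
  by (simp add: field_simps power2_eq_square)

text \<open>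
  The defining quartic of the curve is \<open>\<bar>q\<^sup>2 + q + 1\<bar>\<^sup>2 - \<bar>q\<bar>\<^sup>2\<close> in real coordinates.
\<close>

lemma quartic_curve_iff: "q \<in> quartic_curve \<longleftrightarrow> cmod (q\<^sup>2 + q + 1) = cmod q"
proof -
  define x y where "x = Re q" and "y = Im q"
  have q: "q = Complex x y"
    by (simp add: x_def y_def)
  have coords: "Re (q\<^sup>2 + q + 1) = x\<^sup>2 - y\<^sup>2 + x + 1" "Im (q\<^sup>2 + q + 1) = 2 * x * y + y"
    by (simp_all add: x_def y_def power2_eq_square)
  have "cmod (q\<^sup>2 + q + 1) = cmod q \<longleftrightarrow> (cmod (q\<^sup>2 + q + 1))\<^sup>2 = (cmod q)\<^sup>2"
    by simp
  also have "\<dots> \<longleftrightarrow> (x\<^sup>2 - y\<^sup>2 + x + 1)\<^sup>2 + (2 * x * y + y)\<^sup>2 = x\<^sup>2 + y\<^sup>2"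
    unfolding cmod_power2 coords x_def[symmetric] y_def[symmetric] ..
  also have "\<dots> \<longleftrightarrow> 1 + 2 * x + 2 * x^2 + 2 * x^3 + x^4 - 2 * y^2 + 2 * x * y^2 + 2 * x^2 * y^2 + y^4 = 0"
    by algebra
  also have "\<dots> \<longleftrightarrow> q \<in> quartic_curve"
    unfolding quartic_curve_def q by auto
  finally show ?thesis by blast
qed

lemma half_of_real: "2 * z = of_real u \<Longrightarrow> z = of_real (u / 2)" for z :: complex
  by (simp add: field_simps)

text \<open>
  In terms of \<open>w = q + 1 + 1 / q\<close> the quartic curve is \<open>\<bar>w\<bar> = 1\<close>, which means that \<open>w + 1 / w\<close> is real
  and lies between \<open>- 2\<close> and \<open>2\<close>.  On the arc, \<open>w = 1 + 2 Re q\<close> runs through the reals from \<open>1 / 3\<close> to \<open>3\<close>, and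
  \<open>w + 1 / w\<close> through those from \<open>2\<close> to \<open>10 / 3\<close>.  So the two pieces of the set together are the
  preimage of a single real interval.
\<close>

lemma Gamma_set_iff:
  "q \<in> Gamma_set \<longleftrightarrow> q \<noteq> 0 \<and> q\<^sup>2 + q + 1 \<noteq> 0
    \<and> (\<exists>v. - 2 \<le> v \<and> v \<le> 10 / 3 \<and> resolvent_var q = of_real v)"
proof
  assume "q \<in> Gamma_set"
  then consider (curve) "q \<in> quartic_curve" | (arc) "cmod q = 1" "- 1 / 3 \<le> Re q"
    by (auto simp: Gamma_set_def unit_arc_def)
  then show "q \<noteq> 0 \<and> q\<^sup>2 + q + 1 \<noteq> 0
    \<and> (\<exists>v. - 2 \<le> v \<and> v \<le> 10 / 3 \<and> resolvent_var q = of_real v)"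
  proof cases
    case curve
    then have eq: "cmod (q\<^sup>2 + q + 1) = cmod q"
      by (simp add: quartic_curve_iff)
    then have q: "q \<noteq> 0"
      by auto
    define w where "w = q + 1 + 1 / q"
    have "cmod q * cmod w = cmod q"
      using eq unfolding w_def mult_shift_inverse[OF q, symmetric] norm_mult .
    then have w: "cmod w = 1"
      using q by simp
    have "resolvent_var q = of_real (2 * Re w)"
      using w by (simp add: resolvent_var_def w_def[symmetric] Let_def inverse_of_unit complex_eq_iff)
    moreover have "\<bar>Re w\<bar> \<le> 1"
      using abs_Re_le_cmod[of w] w by simp
    ultimately show ?thesis
      using q eq by (intro conjI exI[of _ "2 * Re w"]) auto
  next
    case arc
    then have q: "q \<noteq> 0"
      by auto
    define w where "w = 1 + 2 * Re q"
    have w: "1 / 3 \<le> w" "w \<le> 3"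
      using arc abs_Re_le_cmod[of q] by (auto simp: w_def)
    have w_eq: "q + 1 + 1 / q = of_real w"
      using arc by (simp add: inverse_of_unit complex_eq_iff w_def)
    then have "resolvent_var q = of_real (w + 1 / w)"
      by (simp add: resolvent_var_def Let_def)
    moreover have "w + 1 / w \<le> 10 / 3"
    proof -
      have "0 \<le> (3 * w - 1) * (3 - w)"
        using w by simp
      then show ?thesis
        using w by (simp add: field_simps power2_eq_square)
    qed
    moreover have "- 2 \<le> w + 1 / w"
      using w by (smt (verit) divide_nonneg_nonneg)
    moreover have "q\<^sup>2 + q + 1 \<noteq> 0"
      using mult_shift_inverse[OF q] q w unfolding w_eq by auto
    ultimately show ?thesis
      using q by blast
  qed
next
  assume asm: "q \<noteq> 0 \<and> q\<^sup>2 + q + 1 \<noteq> 0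
    \<and> (\<exists>v. - 2 \<le> v \<and> v \<le> 10 / 3 \<and> resolvent_var q = of_real v)"
  then obtain v where q: "q \<noteq> 0" "q\<^sup>2 + q + 1 \<noteq> 0"
    and v: "- 2 \<le> v" "v \<le> 10 / 3" "resolvent_var q = of_real v"
    by blast
  define w where "w = q + 1 + 1 / q"
  have w0: "w \<noteq> 0"
    using mult_shift_inverse[OF q(1)] q(2) by (auto simp: w_def)
  have w_eq: "w + 1 / w = of_real v"
    using v(3) by (simp add: resolvent_var_def w_def Let_def)
  show "q \<in> Gamma_set"
  proof (cases "v \<le> 2")
    case True
    then have "cmod w = 1"
      using joukowski_unit[OF w0 w_eq] v by simp
    then have "cmod (q\<^sup>2 + q + 1) = cmod q"
      unfolding mult_shift_inverse[OF q(1), symmetric] w_def[symmetric] norm_mult by simp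
    then show ?thesis
      by (simp add: Gamma_set_def quartic_curve_iff)
  next
    case False
    define d where "d = sqrt (v\<^sup>2 - 4)"
    have "2\<^sup>2 < v\<^sup>2"
      using False by (intro power_strict_mono) auto
    then have d: "d\<^sup>2 = v\<^sup>2 - 4"
      by (simp add: d_def)
    have "w\<^sup>2 + 1 = of_real v * w"
      using w0 w_eq by (simp add: field_simps power2_eq_square)
    then have "(2 * w - of_real (v + d)) * (2 * w - of_real (v - d)) = 0"
      using arg_cong[OF d, of complex_of_real] by simp algebra
    then have "w = of_real ((v + d) / 2) \<or> w = of_real ((v - d) / 2)"
      unfolding mult_eq_0_iff right_minus_eq by (blast intro: half_of_real)
    then obtain x where x: "w = of_real x"
      by blast
    have "complex_of_real (x + 1 / x) = of_real v"
      using w_eq unfolding x by simp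
    then have vx: "x + 1 / x = v"
      by (simp only: of_real_eq_iff)
    moreover have "x \<noteq> 0"
      using w0 x by auto
    ultimately have "x\<^sup>2 + 1 = v * x"
      by (simp add: field_simps power2_eq_square)
    have "0 < x"
    proof (rule ccontr)
      assume "\<not> 0 < x"
      then have "v \<le> 0"
        unfolding vx[symmetric] by (simp add: add_nonpos_nonpos divide_nonneg_nonpos)
      with False show False by simp
    qed
    have "x\<^sup>2 + 1 \<le> 10 / 3 * x"
      unfolding \<open>x\<^sup>2 + 1 = v * x\<close> using v \<open>0 < x\<close> by (intro mult_right_mono) auto
    then have "(3 * x - 1) * (x - 3) \<le> 0"
      by (simp add: algebra_simps power2_eq_square)
    then have x_bounds: "1 / 3 \<le> x" "x \<le> 3"
      by (auto simp: mult_le_0_iff)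
    have q_eq: "q + 1 / q = of_real (x - 1)"
      using x by (simp add: w_def algebra_simps)
    then have unit: "cmod q = 1"
      using joukowski_unit[OF q(1) q_eq] x_bounds by simp
    then have "2 * Re q = x - 1"
      using q_eq by (simp add: inverse_of_unit complex_eq_iff)
    then show ?thesis
      using unit x_bounds by (simp add: Gamma_set_def unit_arc_def)
  qed
qed

text \<open>
  The left-hand side of the resolvent cubic \<open>(v + 2) (v - 2)\<^sup>2 = 1 / c\<close> of \<open>1 - s + c s\<^sup>4\<close>.
\<close>

definition resolvent :: "'a::comm_ring_1 \<Rightarrow> 'a" where
  "resolvent v = (v + 2) * (v - 2)\<^sup>2"

text \<open>
  On the reals the cubic rises to \<open>256 / 27\<close> at \<open>v = - 2 / 3\<close>, falls to 0 at \<open>v = 2\<close> and returns to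
  \<open>256 / 27\<close> at \<open>v = 10 / 3\<close>.  The intermediate value theorem is applied only once, on the last
  branch; the quadratic that remains after dividing by \<open>v - x0\<close> has discriminant
  \<open>(10 - 3 x0) (x0 + 2) \<ge> 0\<close>.
\<close>

lemma resolvent_level_real:
  fixes v :: complex
  assumes level: "resolvent v = of_real l" and "0 < l" "l < 256 / 27"
  obtains x where "v = of_real x" "- 2 \<le> x" "x \<le> 10 / 3"
proof -
  have "continuous_on {2..10 / 3} (resolvent :: real \<Rightarrow> real)"
    unfolding resolvent_def by (intro continuous_intros)
  moreover have "resolvent 2 \<le> l" "l \<le> resolvent (10 / 3)"
    using assms by (simp_all add: resolvent_def power2_eq_square)
  ultimately obtain x0 where x0: "2 \<le> x0" "x0 \<le> 10 / 3" "resolvent x0 = l"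
    using IVT'[of resolvent 2 l "10 / 3"] by auto
  define D where "D = (10 - 3 * x0) * (x0 + 2)"
  define d where "d = sqrt D"
  have "0 \<le> D"
    using x0 by (simp add: D_def)
  then have d: "d\<^sup>2 = D"
    by (simp add: d_def)
  have "complex_of_real (resolvent x0) = resolvent (of_real x0)"
    by (simp add: resolvent_def)
  with level x0(3) have "resolvent v = resolvent (of_real x0)"
    by simp
  then have "(v - of_real x0) * ((2 * v - of_real (2 - x0 + d)) * (2 * v - of_real (2 - x0 - d))) = 0"
    using arg_cong[OF d, of complex_of_real] unfolding resolvent_def D_def by simp algebra
  then have "v = of_real x0 \<or> v = of_real ((2 - x0 + d) / 2) \<or> v = of_real ((2 - x0 - d) / 2)"
    unfolding mult_eq_0_iff right_minus_eq by (blast intro: half_of_real)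
  then obtain x where x: "v = of_real x"
    by blast
  have "complex_of_real (resolvent x) = resolvent (of_real x)"
    by (simp add: resolvent_def)
  with level have l: "resolvent x = l"
    unfolding x by (simp only: of_real_eq_iff)
  have "- 2 \<le> x"
  proof (rule ccontr)
    assume "\<not> - 2 \<le> x"
    then have "resolvent x \<le> 0"
      by (simp add: resolvent_def mult_nonpos_nonneg)
    with l assms show False by simp
  qed
  moreover have "x \<le> 10 / 3"
  proof (rule ccontr)
    assume "\<not> x \<le> 10 / 3"
    then have "(10 / 3 + 2) * (10 / 3 - 2)\<^sup>2 \<le> resolvent x"
      unfolding resolvent_def by (intro mult_mono power_mono) auto
    with l assms show False by (simp add: power2_eq_square)
  qed
  ultimately show ?thesis
    using that x by blast
qed

lemma resolvent_range:
  assumes "- 2 \<le> v" "v \<le> 10 / 3"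
  shows "0 \<le> resolvent v" "resolvent v \<le> (256 / 27 :: real)"
proof -
  show "0 \<le> resolvent v"
    using assms by (simp add: resolvent_def)
  have "27 * resolvent v = 256 - (10 - 3 * v) * (3 * v + 2)\<^sup>2"
    unfolding resolvent_def by algebra
  moreover have "0 \<le> (10 - 3 * v) * (3 * v + 2)\<^sup>2"
    using assms by simp
  ultimately show "resolvent v \<le> 256 / 27"
    by linarith
qed

text \<open>
  The value of \<open>1 / c\<close> for which \<open>1 - s + c s\<^sup>4\<close> has two roots with quotient \<open>q\<close>.
\<close>

definition invariant_of_quotient :: "complex \<Rightarrow> complex" where
  "invariant_of_quotient q = ((q + 1) * (q\<^sup>2 + 1)) ^ 4 / (q * (q\<^sup>2 + q + 1)) ^ 3"

lemma invariant_eq_resolvent: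
  assumes "q \<noteq> 0" "q\<^sup>2 + q + 1 \<noteq> 0"
  shows "invariant_of_quotient q = resolvent (resolvent_var q)"
proof -
  define w where "w = q + 1 + 1 / q"
  have w: "w = (q\<^sup>2 + q + 1) / q"
    using assms by (simp add: w_def field_simps power2_eq_square)
  have w0: "w \<noteq> 0"
    using assms by (simp add: w)
  have plus: "w + 1 = (q + 1)\<^sup>2 / q" and minus: "w - 1 = (q\<^sup>2 + 1) / q"
    using assms by (simp_all add: w_def field_simps power2_eq_square)
  have "resolvent (resolvent_var q) = ((w + 1)\<^sup>2 / w) * ((w - 1)\<^sup>2 / w)\<^sup>2"
  proof -
    have "w + 1 / w + 2 = (w + 1)\<^sup>2 / w" "w + 1 / w - 2 = (w - 1)\<^sup>2 / w"
      using w0 by (simp_all add: field_simps power2_eq_square)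
    then show ?thesis
      by (simp add: resolvent_def resolvent_var_def Let_def w_def)
  qed
  also have "\<dots> = (w + 1)\<^sup>2 * (w - 1) ^ 4 / w ^ 3"
    by (simp add: power_divide power3_eq_cube power4_eq_xxxx power2_eq_square mult.assoc)
  also have "\<dots> = invariant_of_quotient q"
  proof -
    have "((q + 1)\<^sup>2 / q)\<^sup>2 * ((q\<^sup>2 + 1) / q) ^ 4 = ((q + 1) * (q\<^sup>2 + 1)) ^ 4 / q ^ 6"
      by (simp add: power_divide power_mult_distrib flip: power_mult power_add)
    moreover have "w ^ 3 = (q * (q\<^sup>2 + q + 1)) ^ 3 / q ^ 6"
    proof -
      have "q * (q\<^sup>2 + q + 1) = q\<^sup>2 * w"
        using assms(1) by (simp add: w power2_eq_square)
      then show ?thesis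
        using assms(1) by (simp add: power_mult_distrib flip: power_mult)
    qed
    ultimately show ?thesis
      using assms unfolding plus minus invariant_of_quotient_def by simp
  qed
  finally show ?thesis ..
qed

text \<open>
  Dividing the difference of the two equations by \<open>s - t\<close> gives an equation linear in \<open>c t\<^sup>3\<close>, and
  eliminating \<open>c\<close> gives one linear in \<open>t\<close>.
\<close>

lemma invariant_of_roots:
  fixes s t c :: complex
  assumes "1 - s + c * s ^ 4 = 0" "1 - t + c * t ^ 4 = 0" "s \<noteq> t" "c \<noteq> 0"
  defines "q \<equiv> s / t"
  shows "q \<noteq> 0" "q\<^sup>2 + q + 1 \<noteq> 0" "invariant_of_quotient q = 1 / c"
proof -
  have t: "t \<noteq> 0" and "s \<noteq> 0"
    using assms by auto
  then show q0: "q \<noteq> 0"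
    by (simp add: q_def)
  have s: "s = q * t"
    using t by (simp add: q_def)
  have q1: "q \<noteq> 1"
    using assms(3) by (auto simp: s)
  have "(q - 1) * (c * t ^ 3 * ((q + 1) * (q\<^sup>2 + 1)) - 1) * t = 0"
    using assms(1,2) unfolding s by algebra
  then have i: "c * t ^ 3 * ((q + 1) * (q\<^sup>2 + 1)) = 1"
    using q1 t by simp
  have ii: "t * (q * (q\<^sup>2 + q + 1)) = (q + 1) * (q\<^sup>2 + 1)"
    using i assms(2) t by algebra
  show q3: "q\<^sup>2 + q + 1 \<noteq> 0"
    using i ii by auto
  have "((q + 1) * (q\<^sup>2 + 1)) ^ 4 * c = (q * (q\<^sup>2 + q + 1)) ^ 3"
  proof -
    have "((q + 1) * (q\<^sup>2 + 1)) ^ 4 * c = ((q + 1) * (q\<^sup>2 + 1)) * c * (t * (q * (q\<^sup>2 + q + 1))) ^ 3"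
      unfolding ii by (simp add: power4_eq_xxxx power3_eq_cube)
    also have "\<dots> = (c * t ^ 3 * ((q + 1) * (q\<^sup>2 + 1))) * (q * (q\<^sup>2 + q + 1)) ^ 3"
      by (simp add: power_mult_distrib)
    finally show ?thesis
      unfolding i by simp
  qed
  then show "invariant_of_quotient q = 1 / c"
    unfolding invariant_of_quotient_def using assms(4) q0 q3 by (subst frac_eq_eq) auto
qed

text \<open>
  The root \<open>t\<close> is the one forced by the elimination in \<open>invariant_of_roots\<close>.
\<close>

lemma roots_of_invariant:
  fixes q c :: complex
  assumes "q \<noteq> 0" "q\<^sup>2 + q + 1 \<noteq> 0" "q \<noteq> 1" "c \<noteq> 0" "invariant_of_quotient q = 1 / c"
  obtains t where "t \<noteq> 0" "1 - t + c * t ^ 4 = 0" "1 - q * t + c * (q * t) ^ 4 = 0"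
proof -
  define N M where "N = (q + 1) * (q\<^sup>2 + 1)" and "M = q * (q\<^sup>2 + q + 1)"
  have M: "M \<noteq> 0"
    using assms by (simp add: M_def)
  then have eq: "N ^ 4 * c = M ^ 3"
    using assms(4,5) unfolding invariant_of_quotient_def N_def[symmetric] M_def[symmetric]
    by (subst (asm) frac_eq_eq) auto
  with M have N: "N \<noteq> 0"
    by auto
  define t where "t = N / M"
  have "c * t ^ 3 * N = 1"
    using eq M by (simp add: t_def power_divide field_simps power4_eq_xxxx power3_eq_cube)
  then have i: "c * t ^ 3 = 1 / N"
    using N by (simp add: field_simps)
  have diff: "N - M = 1"
    by (simp_all add: N_def M_def algebra_simps power2_eq_square)
  have t4: "c * t ^ 4 = 1 / M"
    using i N M by (simp add: t_def power4_eq_xxxx power3_eq_cube field_simps)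
  show ?thesis
  proof (rule that)
    show "t \<noteq> 0"
      using N M by (simp add: t_def)
    have "1 - t + c * t ^ 4 = (M - N + 1) / M"
      unfolding t4 using M by (simp add: t_def field_simps)
    then show "1 - t + c * t ^ 4 = 0"
      using diff(1) by (simp add: algebra_simps)
    have "1 - q * t + c * (q * t) ^ 4 = 1 - q * t + q ^ 4 * (c * t ^ 4)"
      by (simp add: power_mult_distrib)
    also have "\<dots> = (M - q * N + q ^ 4) / M"
      unfolding t4 using M by (simp add: t_def field_simps)
    also have "M - q * N + q ^ 4 = 0"
      unfolding N_def M_def by algebra
    finally show "1 - q * t + c * (q * t) ^ 4 = 0"
      by simp
  qed
qed

section \<open>Back to the sequence of polynomials\<close>

lemma poly_denom_at: "poly (denom_at A B z) t = 1 + poly B z * t + poly A z * t ^ 4"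
  by (simp add: denom_at_def algebra_simps power4_eq_xxxx)

lemma denom_at_nonzero: "denom_at A B z \<noteq> 0"
  by (simp add: denom_at_def)

lemma root_quotient_of_distinct_roots:
  assumes "poly p s = 0" "poly p t = 0" "s \<noteq> t" "p \<noteq> 0"
  shows "s / t \<in> root_quotients p"
proof -
  have "{#s, t#} \<subseteq># proots p"
    using assms by (auto simp: insert_subset_eq_iff order_root simp flip: count_greater_zero_iff)
  then show ?thesis
    by (auto simp: root_quotients_def)
qed

text \<open>
  A multiple root only contributes the quotient 1, which lies in \<open>Gamma_set\<close> anyway; so only distinct
  roots need an argument.
\<close>

lemma root_quotientsE [consumes 2, case_names double distinct]:
  assumes "q \<in> root_quotients p" "poly p 0 \<noteq> 0"
  obtains (double) "q = 1" | (distinct) s t where "q = s / t" "s \<noteq> t" "poly p s = 0" "poly p t = 0"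
proof -
  obtain s t where q: "q = s / t" and sub: "{#s, t#} \<subseteq># proots p"
    using assms(1) by (auto simp: root_quotients_def)
  have p: "p \<noteq> 0"
    using assms(2) by auto
  have "s \<in># proots p" "t \<in># proots p"
    using sub by (auto dest: mset_subset_eqD)
  then have root: "poly p s = 0" "poly p t = 0"
    using p by auto
  show ?thesis
  proof (cases "s = t")
    case True
    have "t \<noteq> 0"
      using root assms(2) by auto
    then show ?thesis
      using double True q by simp
  qed (use distinct q root in blast)
qed

lemma fourth_roots_of_unity:
  fixes q :: complex
  assumes "q ^ 4 = 1"
  shows "q \<in> {1, - 1, \<i>, - \<i>}"
proof -
  have "(q - 1) * ((q + 1) * ((q - \<i>) * (q + \<i>))) = q ^ 4 - 1"
    by (simp add: algebra_simps power4_eq_xxxx)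
  then show ?thesis
    using assms by (auto simp: eq_neg_iff_add_eq_0)
qed

text \<open>
  If \<open>B(z) \<noteq> 0\<close>, then \<open>c = A(z) / B(z)\<^sup>4\<close> is a zero of the normalised polynomial, hence real and larger
  than \<open>27 / 256\<close>, and the resolvent cubic has all its roots in the interval that describes the set.
  If \<open>B(z) = 0\<close>, the denominator is \<open>1 + A(z) t\<^sup>4\<close> and the quotients are fourth roots of unity.  If
  \<open>A(z) = 0\<close>, it has at most one root.
\<close>

theorem root_quotients_in_Gamma:
  fixes A B :: "complex poly" and H :: "nat \<Rightarrow> complex poly"
  assumes gen: "Abs_fps H * (1 + fps_const B * fps_X + fps_const A * fps_X ^ 4) = 1"
    and root: "poly (H m) z = 0" and q: "q \<in> root_quotients (denom_at A B z)"
  shows "q \<in> Gamma_set"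
proof -
  have "poly (denom_at A B z) 0 \<noteq> 0"
    by (simp add: poly_denom_at)
  with q show ?thesis
  proof (cases rule: root_quotientsE)
    case double
    then show ?thesis
      by (simp add: Gamma_set_def unit_arc_def)
  next
    case (distinct s t)
    define a b where "a = poly A z" and "b = poly B z"
    have s: "1 + b * s + a * s ^ 4 = 0" and t: "1 + b * t + a * t ^ 4 = 0"
      using distinct by (simp_all add: poly_denom_at a_def b_def)
    have a: "a \<noteq> 0"
    proof
      assume "a = 0"
      then have "1 + b * s = 0" "1 + b * t = 0"
        using s t by simp_all
      then have "b * (s - t) = 0" and "b \<noteq> 0"
        by (algebra, auto)
      with distinct show False by simp
    qed
    show ?thesis
    proof (cases "b = 0")
      case True
      then have "a * s ^ 4 = a * t ^ 4" and "t \<noteq> 0"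
        using s t by (auto simp: add_eq_0_iff)
      then have "q ^ 4 = 1"
        using a by (simp add: distinct(1) power_divide)
      from fourth_roots_of_unity[OF this] show ?thesis
        by (auto simp: Gamma_set_def unit_arc_def quartic_curve_iff norm_minus_commute power2_eq_square)
    next
      case False
      define c where "c = a / b ^ 4"
      have c: "c \<noteq> 0"
        using a False by (simp add: c_def)
      have "poly (tri_poly m) c = 0"
        using root poly_eq_scaled_tri_poly[OF gen, of z m] False by (simp add: c_def a_def b_def)
      then obtain x where x: "c = of_real x" "27 / 256 < x"
        using tri_poly_roots_real by blast
      have scale: "1 - (- b * u) + c * (- b * u) ^ 4 = 1 + b * u + a * u ^ 4" for u
        using False by (simp add: c_def power_mult_distrib)
      have "q = (- b * s) / (- b * t)"
        using False distinct(1) by simp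
      moreover have "- b * s \<noteq> - b * t"
        using False distinct(2) by simp
      ultimately have q: "q \<noteq> 0" "q\<^sup>2 + q + 1 \<noteq> 0" "invariant_of_quotient q = 1 / c"
        using invariant_of_roots[of "- b * s" c "- b * t"] c s t unfolding scale by simp_all
      have "resolvent (resolvent_var q) = of_real (1 / x)"
        using invariant_eq_resolvent[OF q(1,2)] q(3) x(1) by simp
      moreover have "0 < 1 / x" "1 / x < 256 / 27"
        using x(2) by (simp_all add: field_simps)
      ultimately obtain v where "resolvent_var q = of_real v" "- 2 \<le> v" "v \<le> 10 / 3"
        by (rule resolvent_level_real)
      then show ?thesis
        using q Gamma_set_iff by blast
    qed
  qed
qed

lemma cancel_common_roots:
  fixes A F :: "'a::idom poly"
  assumes "A \<noteq> 0"
  shows "\<exists>G A' F'. A = A' * G \<and> F = F' * G \<and> (\<forall>z. poly A' z = 0 \<longrightarrow> poly F' z \<noteq> 0)"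
  using assms
proof (induction "degree A" arbitrary: A F)
  case 0
  then obtain u where "A = [:u:]" "u \<noteq> 0"
    by (metis degree_eq_zeroE pCons_0_0)
  then show ?case
    by (intro exI[of _ 1] exI[of _ A] exI[of _ F]) auto
next
  case (Suc n)
  show ?case
  proof (cases "\<exists>z. poly A z = 0 \<and> poly F z = 0")
    case True
    then obtain z A1 F1 where A: "A = [:- z, 1:] * A1" and F: "F = [:- z, 1:] * F1"
      by (auto simp: poly_eq_0_iff_dvd elim!: dvdE)
    have "A1 \<noteq> 0"
      using A Suc.prems by auto
    moreover from this have "n = degree A1"
      using Suc.hyps(2) unfolding A by (subst (asm) degree_mult_eq) auto
    ultimately obtain G A' F' where "A1 = A' * G" "F1 = F' * G"
      and "\<forall>z. poly A' z = 0 \<longrightarrow> poly F' z \<noteq> 0"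
      using Suc.hyps(1)[of A1 F1] by blast
    then show ?thesis
      by (intro exI[of _ "[:- z, 1:] * G"] exI[of _ A'] exI[of _ F'])
         (simp add: A F mult.left_commute del: mult_pCons_left)
  next
    case False
    then show ?thesis
      by (intro exI[of _ 1] exI[of _ A] exI[of _ F]) auto
  qed
qed

text \<open>
  Cancelling the common roots of \<open>A\<close> and \<open>F\<close> leaves \<open>A'\<close> and \<open>F'\<close>.  At most one \<open>c\<close> makes \<open>A' - c F'\<close>
  constant.  For any other \<open>c\<close> it has a zero \<open>z\<close>, where \<open>F'\<close> cannot vanish too.  This \<open>z\<close> attains
  the ratio \<open>c\<close> unless it is one of the finitely many zeros of the common factor \<open>G\<close>.
\<close>

lemma finite_unattained_ratios:
  fixes A F :: "complex poly"
  assumes "A \<noteq> 0" "\<nexists>c. F = smult c A"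
  shows "finite {c. \<nexists>z. poly F z \<noteq> 0 \<and> poly A z = c * poly F z}"
proof -
  obtain G A' F' where A: "A = A' * G" and F: "F = F' * G"
    and no_common_root: "\<And>z. poly A' z = 0 \<Longrightarrow> poly F' z \<noteq> 0"
    using cancel_common_roots[OF assms(1)] by metis
  have G: "G \<noteq> 0" and A': "A' \<noteq> 0"
    using assms(1) A by auto
  have constants: "\<not> (degree A' = 0 \<and> degree F' = 0)"
  proof
    assume "degree A' = 0 \<and> degree F' = 0"
    then obtain u v where "A' = [:u:]" "F' = [:v:]"
      by (meson degree_eq_zeroE)
    then have "F = smult (v / u) A"
      using A F A' by simp
    with assms(2) show False by blast
  qed
  define K where "K = {c. degree (A' - smult c F') = 0}"
  have "c = d" if "c \<in> K" "d \<in> K" for c d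
  proof (rule ccontr)
    assume "c \<noteq> d"
    have "degree ((A' - smult d F') - (A' - smult c F')) \<le> 0"
      by (rule degree_diff_le; use that in \<open>simp add: K_def\<close>)
    then have "degree (smult (c - d) F') = 0"
      by (simp add: smult_diff_left)
    then have "degree F' = 0"
      using \<open>c \<noteq> d\<close> by simp
    moreover have "degree ((A' - smult c F') + smult c F') \<le> 0"
      by (rule degree_add_le; use that calculation in \<open>simp add: K_def\<close>)
    ultimately show False
      using constants by simp
  qed
  then have "finite K"
    by (metis (full_types) finite.simps is_singletonI' is_singleton_def)
  moreover have "finite ((\<lambda>z. poly A' z / poly F' z) ` {z. poly G z = 0})"
    using G by (intro finite_imageI poly_roots_finite)
  moreover have "{c. \<nexists>z. poly F z \<noteq> 0 \<and> poly A z = c * poly F z}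
      \<subseteq> K \<union> (\<lambda>z. poly A' z / poly F' z) ` {z. poly G z = 0}"
  proof
    fix c assume "c \<in> {c. \<nexists>z. poly F z \<noteq> 0 \<and> poly A z = c * poly F z}"
    then have unattained: "\<And>z. poly F z \<noteq> 0 \<Longrightarrow> poly A z \<noteq> c * poly F z"
      by blast
    show "c \<in> K \<union> (\<lambda>z. poly A' z / poly F' z) ` {z. poly G z = 0}"
    proof (cases "c \<in> K")
      case False
      then obtain z where z: "poly (A' - smult c F') z = 0"
        using Fundamental_Theorem_Algebra.fundamental_theorem_of_algebra[of "A' - smult c F'"]
        by (auto simp: K_def constant_degree)
      then have A'z: "poly A' z = c * poly F' z"
        by simp
      have F'z: "poly F' z \<noteq> 0"
        using no_common_root[of z] A'z by auto
      have "poly G z = 0"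
        using unattained[of z] F'z A'z by (auto simp: A F)
      moreover have "c = poly A' z / poly F' z"
        using A'z F'z by simp
      ultimately show ?thesis by blast
    qed blast
  qed
  ultimately show ?thesis
    by (meson finite_UnI finite_subset)
qed

text \<open>
  The open mapping theorem; the function is not constant because its values at \<open>1\<close> and \<open>- 1\<close> differ.
  It stays defined at the points \<open>\<i>\<close>, \<open>- \<i>\<close> and \<open>- 1\<close> of the curve, where \<open>c\<close> itself is infinite; this
  is the reason for using \<open>1 / c\<close>.
\<close>

lemma invariant_locally_open:
  assumes "open U" "p \<in> U" "p \<noteq> 0" "p\<^sup>2 + p + 1 \<noteq> 0"
  obtains V where "open V" "invariant_of_quotient p \<in> V"
    "\<And>k. k \<in> V \<Longrightarrow> \<exists>q\<in>U. q \<noteq> 0 \<and> q\<^sup>2 + q + 1 \<noteq> 0 \<and> invariant_of_quotient q = k"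
proof -
  define Z where "Z = {q. poly [:0, 1, 1, 1:] q = (0 :: complex)}"
  define S where "S = - Z"
  have S: "S = {q. q \<noteq> 0 \<and> q\<^sup>2 + q + 1 \<noteq> 0}"
  proof -
    have "poly [:0, 1, 1, 1:] q = q * (q\<^sup>2 + q + 1)" for q :: complex
      by (simp add: algebra_simps power2_eq_square)
    then show ?thesis
      by (auto simp: S_def Z_def simp del: poly_pCons)
  qed
  have "finite Z"
    unfolding Z_def by (rule poly_roots_finite) simp
  then have "open S"
    unfolding S_def by (intro open_Compl finite_imp_closed)
  have "connected S"
    unfolding S_def Compl_eq_Diff_UNIV
    using \<open>finite Z\<close> by (intro connected_open_delete_finite) (auto simp: connected_UNIV)
  have holo: "invariant_of_quotient holomorphic_on S"
    unfolding invariant_of_quotient_def S by (intro holomorphic_intros) auto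
  have "\<not> invariant_of_quotient constant_on S"
  proof
    assume "invariant_of_quotient constant_on S"
    moreover have "1 \<in> S" "- 1 \<in> S"
      by (simp_all add: S)
    ultimately have "invariant_of_quotient 1 = invariant_of_quotient (- 1)"
      unfolding constant_on_def by metis
    then show False
      by (simp add: invariant_of_quotient_def)
  qed
  then have "open (invariant_of_quotient ` (U \<inter> S))"
    using holo \<open>open S\<close> \<open>connected S\<close> assms(1) by (intro open_mapping_thm[of _ S]) auto
  moreover have "invariant_of_quotient p \<in> invariant_of_quotient ` (U \<inter> S)"
    using assms by (auto simp: S)
  ultimately show ?thesis
    by (rule that) (auto simp: S)
qed

text \<open>
  Near a point of the set, the quotients realise all values of \<open>1 / c\<close> in an open set that meets the
  interval from 0 to \<open>256 / 27\<close>.  For large \<open>m\<close> a zero \<open>c\<close> of the normalised polynomial falls into this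
  set.  Removing finitely many values beforehand ensures that \<open>c = A(z) / B(z)\<^sup>4\<close> for some \<open>z\<close> with
  \<open>B(z) \<noteq> 0\<close>; such a \<open>z\<close> is a zero of \<open>H m\<close>.
\<close>

theorem root_quotients_dense:
  fixes A B :: "complex poly" and H :: "nat \<Rightarrow> complex poly"
  assumes gen: "Abs_fps H * (1 + fps_const B * fps_X + fps_const A * fps_X ^ 4) = 1"
    and A: "A \<noteq> 0" "\<nexists>c. B ^ 4 = smult c A" and p: "p \<in> Gamma_set" and U: "open U" "p \<in> U"
  shows "\<forall>\<^sub>F m in sequentially. \<exists>z q. poly (H m) z = 0 \<and> q \<in> root_quotients (denom_at A B z) \<and> q \<in> U"
proof -
  obtain v where v: "- 2 \<le> v" "v \<le> 10 / 3" "resolvent_var p = of_real v"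
    and p0: "p \<noteq> 0" "p\<^sup>2 + p + 1 \<noteq> 0"
    using p Gamma_set_iff by blast
  obtain V where V: "open V" "invariant_of_quotient p \<in> V"
    and V_attained: "\<And>k. k \<in> V \<Longrightarrow> \<exists>q\<in>U. q \<noteq> 0 \<and> q\<^sup>2 + q + 1 \<noteq> 0 \<and> invariant_of_quotient q = k"
    using invariant_locally_open[OF U p0] by metis
  define W where "W = complex_of_real -` V"
  define k0 where "k0 = resolvent v"
  have "open W"
    unfolding W_def using V(1) by (intro open_vimage continuous_intros)
  have "invariant_of_quotient p = of_real k0"
    using invariant_eq_resolvent[OF p0] v(3) by (simp add: k0_def resolvent_def)
  then have "k0 \<in> W"
    using V(2) by (simp add: W_def)
  have "k0 \<in> closure {0<..<256 / 27}"
    using resolvent_range[OF v(1,2)] by (simp add: k0_def)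
  then have nonempty: "W \<inter> {0<..<256 / 27} \<noteq> {}"
    using \<open>open W\<close> \<open>k0 \<in> W\<close> open_Int_closure_eq_empty[of W "{0<..<256 / 27}"] by blast
  define bad where "bad = {c. \<nexists>z. poly (B ^ 4) z \<noteq> 0 \<and> poly A z = c * poly (B ^ 4) z}"
  define bad_k where "bad_k = (\<lambda>c. 1 / Re c) ` bad"
  have "finite bad_k"
    unfolding bad_k_def bad_def using A by (intro finite_imageI finite_unattained_ratios)
  have "open (W \<inter> {0<..<256 / 27})"
    using \<open>open W\<close> by (intro open_Int open_greaterThanLessThan)
  then have "infinite (W \<inter> {0<..<256 / 27})"
    using nonempty finite_imp_not_open by blast
  then have "W \<inter> {0<..<256 / 27} - bad_k \<noteq> {}"
    using \<open>finite bad_k\<close> by (metis finite.emptyI finite_Diff2)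
  moreover have "open (W \<inter> {0<..<256 / 27} - bad_k)"
    using \<open>open W\<close> \<open>finite bad_k\<close> by (intro open_Diff open_Int finite_imp_closed) auto
  ultimately obtain k e where "0 < e" and ball: "ball k e \<subseteq> W \<inter> {0<..<256 / 27} - bad_k"
    using open_contains_ball by (metis ex_in_conv)
  have interval: "{k..<k + e} \<subseteq> W \<inter> {0<..<256 / 27} - bad_k"
    using ball by (force simp: dist_real_def)
  define k' where "k' = k + e / 2"
  have k: "0 < k" "k < k'" "k' < 256 / 27" "{k..k'} \<subseteq> W - bad_k"
  proof -
    have "k' \<in> {k..<k + e}" "k \<in> {k..<k + e}" "{k..k'} \<subseteq> {k..<k + e}"
      using \<open>0 < e\<close> by (auto simp: k'_def)
    with interval have "k' \<in> {0<..<256 / 27}" "k \<in> {0<..<256 / 27}"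
        and sub: "{k..k'} \<subseteq> W - bad_k"
      by blast+
    then show "0 < k" "k' < 256 / 27"
      by simp_all
    show "{k..k'} \<subseteq> W - bad_k"
      by (fact sub)
    show "k < k'"
      using \<open>0 < e\<close> by (simp add: k'_def)
  qed
  have "27 / 256 < 1 / k'" "1 / k' < 1 / k"
    using k by (simp_all add: field_simps)
  from tri_poly_roots_dense[OF this] show ?thesis
  proof eventually_elim
    case (elim m)
    then obtain x where x: "1 / k' < x" "x < 1 / k" "poly (tri_poly m) x = 0"
      by blast
    have "0 < x"
      using x(1) k by (smt (verit) divide_pos_pos)
    then have x_range: "k < 1 / x" "1 / x < k'"
      using x k by (simp_all add: field_simps)
    then have "1 / x \<in> {k..k'}"
      by simp
    with k(4) have "1 / x \<in> W - bad_k"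
      by (rule subsetD)
    then have "complex_of_real x \<notin> bad" and "complex_of_real (1 / x) \<in> V"
      by (force simp: bad_k_def, simp add: W_def)
    then obtain z where z: "poly B z \<noteq> 0" "poly A z = of_real x * poly B z ^ 4"
      by (auto simp: bad_def)
    obtain q where q: "q \<in> U" "q \<noteq> 0" "q\<^sup>2 + q + 1 \<noteq> 0" "invariant_of_quotient q = 1 / of_real x"
      using V_attained[OF \<open>complex_of_real (1 / x) \<in> V\<close>] by auto
    \<comment> \<open>The value of the invariant at 1 is 256 / 27, an endpoint of the interval.\<close>
    have "q \<noteq> 1"
    proof
      assume "q = 1"
      then have "complex_of_real (1 / x) = of_real (256 / 27)"
        using q(4) by (simp add: invariant_of_quotient_def)
      then have "1 / x = 256 / 27"
        by (simp only: of_real_eq_iff)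
      with x_range k show False by linarith
    qed
    then obtain t where t: "t \<noteq> 0" "1 - t + of_real x * t ^ 4 = 0" "1 - q * t + of_real x * (q * t) ^ 4 = 0"
      using roots_of_invariant[OF q(2,3), of "of_real x"] q(4) \<open>0 < x\<close> by auto
    define b where "b = poly B z"
    have scale: "poly (denom_at A B z) (- u / b) = 1 - u + of_real x * u ^ 4" for u
      using z by (simp add: poly_denom_at b_def power_divide)
    have "(- (q * t) / b) / (- t / b) \<in> root_quotients (denom_at A B z)"
      using t \<open>q \<noteq> 1\<close> z(1)
      by (intro root_quotient_of_distinct_roots denom_at_nonzero) (simp_all only: scale, simp_all add: b_def)
    moreover have "(- (q * t) / b) / (- t / b) = q"
      using t(1) z(1) by (simp add: b_def)
    moreover have "poly (H m) z = 0"
    proof -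
      have "poly A z / poly B z ^ 4 = of_real x"
        using z by simp
      then show ?thesis
        using poly_eq_scaled_tri_poly[OF gen z(1), of m] x(3) by (simp add: poly_tri_poly_of_real)
    qed
    ultimately show ?case
      using q(1) by auto
  qed
qed

theorem lemma4:
  fixes A B :: "complex poly" and H :: "nat \<Rightarrow> complex poly"
  assumes gen: "Abs_fps H * (1 + fps_const B * fps_X + fps_const A * fps_X ^ 4) = 1"
  shows "(\<forall>m z0 q. poly (H m) z0 = 0 \<longrightarrow> q \<in> root_quotients (denom_at A B z0) \<longrightarrow> q \<in> Gamma_set) \<and>
         (A \<noteq> 0 \<and> (\<nexists>c. B ^ 4 = smult c A) \<longrightarrow>
           (\<forall>p \<in> Gamma_set. \<forall>U. open U \<longrightarrow> p \<in> U \<longrightarrow>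
             (\<exists>M. \<forall>m \<ge> M. \<exists>z0 q. poly (H m) z0 = 0 \<and>
                q \<in> root_quotients (denom_at A B z0) \<and> q \<in> U)))"
  using root_quotients_in_Gamma[OF gen] root_quotients_dense[OF gen]
  unfolding eventually_sequentially by blast

end
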